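(* Let $d\ge2$, let $E\subset\mathbb{R}^d$ be a bounded Borel set with $|E|>0$, and for every measurable $F$ let $\mu(F)=|E\cap F|/|E|$. Assume there exists $c_1>0$ such that $c_1r^d\le\mu(B(x,r))$ for every $x\in E$ and every $0<r<\operatorname{diam}(E)$. Let $\Omega\subseteq\mathbb{R}^d$ be a bounded Borel set such that, for some $0<\beta\le1$ and $c'>0$, $|\{z\in\mathbb{R}^d:\operatorname{dist}(z,\partial\Omega)\le t\}|\le c' t^\beta$ for every $0<t<1$. Let $0<a<b$. Then there exists $c>0$ such that for every $N$ there exists a point distribution $\mathcal{P}_N=\{z_1,\dots,z_N\}\subset E$ with $$\left\{\int_a^b\int_{SO(d)}\int_{\mathbb{R}^d}\left|\mathcal{D}_N(x+\tau\sigma\Omega)\right|^2dx\,d\sigma\,d\tau\right\}^{1/2}\le c\,N^{1/2-\beta/(2d)}.$$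
   Context: $|F|$ is Lebesgue measure. $\mathcal{D}_N(R)=\mathrm{card}(\mathcal{P}_N\cap R)-N\mu(R)$. $d\sigma$ is normalized Haar measure on $SO(d)$. *)

theory Defs
  imports "HOL-Analysis.Analysis" "HOL-Probability.Probability"
begin

definition SO_set :: "(real^'n^'n) set" where
  "SO_set = {A. orthogonal_matrix A \<and> det A = 1}"

definition is_haar_SO :: "(real^'n^'n) measure \<Rightarrow> bool" where
  "is_haar_SO \<nu> \<longleftrightarrow>
     sets \<nu> = sets (restrict_space borel SO_set) \<and>
     prob_space \<nu> \<and>
     (\<forall>g\<in>SO_set. \<forall>A\<in>sets \<nu>. emeasure \<nu> ((\<lambda>s. g ** s) ` A) = emeasure \<nu> A)"

definition mu_E :: "(real^'n) set \<Rightarrow> (real^'n) set \<Rightarrow> real" where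
  "mu_E E F = measure lebesgue (E \<inter> F) / measure lebesgue E"

definition discrepancy :: "(real^'n) set \<Rightarrow> (real^'n) set \<Rightarrow> (real^'n) set \<Rightarrow> real" where
  "discrepancy E P R = real (card (P \<inter> R)) - real (card P) * mu_E E R"

definition moved_set :: "real^'n \<Rightarrow> real \<Rightarrow> real^'n^'n \<Rightarrow> (real^'n) set \<Rightarrow> (real^'n) set" where
  "moved_set x \<tau> \<sigma> \<Omega> = (\<lambda>w. x + \<tau> *\<^sub>R (\<sigma> *v w)) ` \<Omega>"

end

theory Submission
  imports Defs
begin

text \<open>
  Cut \<open>E\<close> into \<open>N\<close> pieces of equal measure and pick one point in each. If the points are chosen
  uniformly and independently, the discrepancy is a sum of independent centred variables, and the
  \<open>j\<close>-th variance, integrated over all motions, is at most the measure of the motions that separate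
  two points of the \<open>j\<close>-th piece. By the hypothesis on the boundary of \<open>\<Omega>\<close> this is \<open>O(\<delta>\<^sub>j\<^sup>\<beta>)\<close>, where
  \<open>\<delta>\<^sub>j\<close> is the diameter of the piece. Choosing the points one at a time, never above the
  conditional average, avoids the product measure.

  It is not necessary that every piece has diameter \<open>O(N\<^sup>-\<^sup>1\<^sup>/\<^sup>d)\<close>: it suffices that the sum of the
  \<open>\<delta>\<^sub>j\<^sup>\<beta>\<close> is \<open>O(N\<^sup>1\<^sup>-\<^sup>\<beta>\<^sup>/\<^sup>d)\<close>. Split a box around \<open>E\<close> into \<open>m\<^sup>d\<^sup>-\<^sup>1\<close> columns with \<open>m\<close> about \<open>N\<^sup>1\<^sup>/\<^sup>d\<close>, order the
  points of \<open>E\<close> by column and then by height, and cut this order into \<open>N\<close> consecutive pieces of equal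
  measure. At most \<open>m\<^sup>d\<^sup>-\<^sup>1\<close> pieces straddle two columns, and the heights of the others add up.
\<close>

subsection \<open>Choosing points by averaging\<close>

text \<open>A function cannot lie strictly above its own mean almost everywhere. The point is sought
  in a set \<open>A\<close> of full measure because later it has to belong to a prescribed
  piece.\<close>

lemma (in prob_space) exists_le_nn_integral:
  fixes f :: "'a \<Rightarrow> ennreal"
  assumes [measurable]: "f \<in> borel_measurable M" and A: "AE x in M. x \<in> A"
  shows "\<exists>x\<in>A. f x \<le> (\<integral>\<^sup>+ x. f x \<partial>M)"
proof (rule ccontr)
  let ?I = "\<integral>\<^sup>+ x. f x \<partial>M"
  assume "\<not> ?thesis"
  then have less: "\<And>x. x \<in> A \<Longrightarrow> ?I < f x"
    by (auto simp: not_le)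
  have AE_less: "AE x in M. ?I < f x"
    using A by eventually_elim (rule less)
  \<comment> \<open>Strict monotonicity of the integral needs the smaller side to be finite. Nothing
    lies strictly above an infinite mean, so that case is excluded first.\<close>
  have fin: "?I \<noteq> \<infinity>"
  proof
    assume "?I = \<infinity>"
    with AE_less have "AE x in M. False"
      by (auto elim!: eventually_mono simp: top.extremum_strict)
    then show False
      by (simp add: AE_False)
  qed
  have "(\<integral>\<^sup>+ x. ?I \<partial>M) < (\<integral>\<^sup>+ x. f x \<partial>M)"
  proof (rule nn_integral_less)
    show "(\<integral>\<^sup>+ x. ?I \<partial>M) \<noteq> \<infinity>"
      using fin by (simp add: emeasure_space_1)
    show "AE x in M. ?I \<le> f x"
      using AE_less by eventually_elim simp
    show "\<not> (AE x in M. f x \<le> ?I)"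
    proof
      assume "AE x in M. f x \<le> ?I"
      with AE_less have "AE x in M. False"
        by eventually_elim (simp add: not_le[symmetric])
      then show False
        by (simp add: AE_False)
    qed
  qed simp_all
  then show False
    by (simp add: emeasure_space_1)
qed

text \<open>The cross term with \<open>G\<close> vanishes because \<open>h - expectation h\<close>
  is centred, which leaves the variance of \<open>h\<close>. The mean minimises the quadratic
  deviation, so any constant \<open>c\<close> may replace it, and a deviation of at most 1 dominates
  its own square.\<close>

lemma (in prob_space) nn_integral_shifted_square_le:
  fixes h :: "'a \<Rightarrow> real"
  assumes [measurable]: "h \<in> borel_measurable M" and h: "\<And>x. 0 \<le> h x" "\<And>x. h x \<le> 1"
    and c: "0 \<le> c" "c \<le> 1"
  shows "(\<integral>\<^sup>+ x. ennreal ((G + (h x - expectation h))\<^sup>2) \<partial>M)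
         \<le> ennreal (G\<^sup>2) + (\<integral>\<^sup>+ x. ennreal \<bar>h x - c\<bar> \<partial>M)"
proof -
  let ?m = "expectation h"
  have int: "integrable M h"
    by (rule integrable_const_bound[where B=1]) (use h in auto)
  have int2: "integrable M (\<lambda>x. (h x)\<^sup>2)"
    by (rule integrable_const_bound[where B=1]) (use h in \<open>auto simp: power_le_one\<close>)
  have intc: "integrable M (\<lambda>x. \<bar>h x - c\<bar>)"
    using int by auto
  have expand: "(\<lambda>x. (G + (h x - ?m))\<^sup>2) = (\<lambda>x. (h x)\<^sup>2 + 2 * (G - ?m) * h x + (G - ?m)\<^sup>2)"
    by (auto simp: power2_eq_square algebra_simps)
  have expand_c: "(\<lambda>x. (h x - c)\<^sup>2) = (\<lambda>x. (h x)\<^sup>2 - 2 * c * h x + c\<^sup>2)"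
    by (auto simp: power2_eq_square algebra_simps)
  have i1: "integrable M (\<lambda>x. (G + (h x - ?m))\<^sup>2)"
    unfolding expand using int int2 by auto
  have i2: "integrable M (\<lambda>x. (h x - c)\<^sup>2)"
    unfolding expand_c using int int2 by auto
  have e1: "expectation (\<lambda>x. (G + (h x - ?m))\<^sup>2) = expectation (\<lambda>x. (h x)\<^sup>2) + G\<^sup>2 - ?m\<^sup>2"
    unfolding expand using int int2
    by (simp add: prob_space) (simp add: power2_eq_square algebra_simps)
  have e2: "expectation (\<lambda>x. (h x - c)\<^sup>2) = expectation (\<lambda>x. (h x)\<^sup>2) - 2 * c * ?m + c\<^sup>2"
    unfolding expand_c using int int2 by (simp add: prob_space)
  have "0 \<le> (?m - c)\<^sup>2"
    by simp
  then have "expectation (\<lambda>x. (G + (h x - ?m))\<^sup>2) \<le> G\<^sup>2 + expectation (\<lambda>x. (h x - c)\<^sup>2)"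
    unfolding e1 e2 by (simp add: power2_eq_square algebra_simps)
  also have "expectation (\<lambda>x. (h x - c)\<^sup>2) \<le> expectation (\<lambda>x. \<bar>h x - c\<bar>)"
  proof (rule integral_mono[OF i2 intc])
    fix x
    have "\<bar>h x - c\<bar> \<le> 1"
      using h[of x] c by (simp add: abs_le_iff)
    then have "\<bar>h x - c\<bar> * \<bar>h x - c\<bar> \<le> \<bar>h x - c\<bar> * 1"
      by (intro mult_left_mono) auto
    then show "(h x - c)\<^sup>2 \<le> \<bar>h x - c\<bar>"
      by (simp add: power2_eq_square)
  qed
  finally have "ennreal (expectation (\<lambda>x. (G + (h x - ?m))\<^sup>2))
      \<le> ennreal (G\<^sup>2 + expectation (\<lambda>x. \<bar>h x - c\<bar>))"
    by (intro ennreal_leI) simp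
  also have "\<dots> = ennreal (G\<^sup>2) + ennreal (expectation (\<lambda>x. \<bar>h x - c\<bar>))"
    by (intro ennreal_plus) auto
  finally show ?thesis
    using i1 intc by (simp add: nn_integral_eq_integral)
qed

text \<open>\<open>G\<close> stands for the discrepancy accumulated by the points already chosen.
  Tonelli moves the average over \<open>z\<close> inside, where the variance estimate applies with
  \<open>c\<close> equal to \<open>h \<theta> u\<close>. The reference point \<open>u\<close> thus
  turns a variance into the separation of two points, which \<open>B\<close> bounds.\<close>

lemma exists_point_square_integral_le:
  fixes h :: "'t \<Rightarrow> 's \<Rightarrow> real" and Q :: "'t measure"
  assumes Q: "sigma_finite_measure Q" and p: "prob_space p"
    and [measurable]: "G \<in> borel_measurable Q"
    and h[measurable]: "(\<lambda>(\<theta>, z). h \<theta> z) \<in> borel_measurable (Q \<Otimes>\<^sub>M p)"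
    and h01: "\<And>\<theta> z. 0 \<le> h \<theta> z" "\<And>\<theta> z. h \<theta> z \<le> 1"
    and A: "AE z in p. z \<in> A" and u: "u \<in> space p"
    and B: "\<And>z. z \<in> A \<Longrightarrow> (\<integral>\<^sup>+ \<theta>. ennreal \<bar>h \<theta> z - h \<theta> u\<bar> \<partial>Q) \<le> B"
  shows "\<exists>z\<in>A. (\<integral>\<^sup>+ \<theta>. ennreal ((G \<theta> + (h \<theta> z - (\<integral>w. h \<theta> w \<partial>p)))\<^sup>2) \<partial>Q)
           \<le> (\<integral>\<^sup>+ \<theta>. ennreal ((G \<theta>)\<^sup>2) \<partial>Q) + B"
proof -
  interpret Q: sigma_finite_measure Q by fact
  interpret p: prob_space p by fact
  interpret pair_sigma_finite Q p ..
  have [measurable]: "(\<lambda>x. h (f x) (g x)) \<in> borel_measurable M"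
    if [measurable]: "f \<in> measurable M Q" "g \<in> measurable M p" for f g and M :: "'x measure"
    using measurable_compose[OF measurable_Pair[OF that] h] by simp
  have [measurable]: "(\<lambda>(z, \<theta>). h \<theta> z) \<in> borel_measurable (p \<Otimes>\<^sub>M Q)"
    by (subst measurable_split_conv) measurable
  have [measurable]: "(\<lambda>\<theta>. h \<theta> u) \<in> borel_measurable Q"
    using u by measurable
  have hp: "h \<theta> \<in> borel_measurable p" if "\<theta> \<in> space Q" for \<theta>
    using that by measurable
  let ?m = "\<lambda>\<theta>. \<integral>w. h \<theta> w \<partial>p"
  have [measurable]: "?m \<in> borel_measurable Q"
    by measurable
  let ?F = "\<lambda>z. \<integral>\<^sup>+ \<theta>. ennreal ((G \<theta> + (h \<theta> z - ?m \<theta>))\<^sup>2) \<partial>Q"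
  have "\<exists>z\<in>A. ?F z \<le> (\<integral>\<^sup>+ z. ?F z \<partial>p)"
    by (rule p.exists_le_nn_integral[OF _ A]) measurable
  then obtain z where z: "z \<in> A" "?F z \<le> (\<integral>\<^sup>+ z. ?F z \<partial>p)"
    by blast
  note z(2)
  also have "(\<integral>\<^sup>+ z. ?F z \<partial>p) = (\<integral>\<^sup>+ \<theta>. (\<integral>\<^sup>+ z. ennreal ((G \<theta> + (h \<theta> z - ?m \<theta>))\<^sup>2) \<partial>p) \<partial>Q)"
    by (rule Fubini') measurable
  also have "\<dots> \<le> (\<integral>\<^sup>+ \<theta>. (ennreal ((G \<theta>)\<^sup>2) + (\<integral>\<^sup>+ z. ennreal \<bar>h \<theta> z - h \<theta> u\<bar> \<partial>p)) \<partial>Q)"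
    by (rule nn_integral_mono) (intro p.nn_integral_shifted_square_le hp h01)
  also have "\<dots> = (\<integral>\<^sup>+ \<theta>. ennreal ((G \<theta>)\<^sup>2) \<partial>Q) + (\<integral>\<^sup>+ \<theta>. (\<integral>\<^sup>+ z. ennreal \<bar>h \<theta> z - h \<theta> u\<bar> \<partial>p) \<partial>Q)"
    by (rule nn_integral_add) measurable
  also have "(\<integral>\<^sup>+ \<theta>. (\<integral>\<^sup>+ z. ennreal \<bar>h \<theta> z - h \<theta> u\<bar> \<partial>p) \<partial>Q)
      = (\<integral>\<^sup>+ z. (\<integral>\<^sup>+ \<theta>. ennreal \<bar>h \<theta> z - h \<theta> u\<bar> \<partial>Q) \<partial>p)"
    by (rule Fubini'[symmetric]) measurable
  also have "\<dots> \<le> (\<integral>\<^sup>+ z. B \<partial>p)"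
    by (rule nn_integral_mono_AE) (use A B in \<open>auto elim: eventually_mono\<close>)
  also have "\<dots> = B"
    by (simp add: p.emeasure_space_1)
  finally show ?thesis
    using z(1) by (auto simp: add_left_mono)
qed

lemma exists_points_square_integral_le:
  fixes h :: "'t \<Rightarrow> 's \<Rightarrow> real" and Q :: "'t measure" and N :: nat
  assumes Q: "sigma_finite_measure Q" and p: "\<And>j. j < N \<Longrightarrow> prob_space (p j)"
    and h: "\<And>j. j < N \<Longrightarrow> (\<lambda>(\<theta>, z). h \<theta> z) \<in> borel_measurable (Q \<Otimes>\<^sub>M p j)"
    and h01: "\<And>\<theta> z. 0 \<le> h \<theta> z" "\<And>\<theta> z. h \<theta> z \<le> 1"
    and A: "\<And>j. j < N \<Longrightarrow> AE z in p j. z \<in> A j" "\<And>j. j < N \<Longrightarrow> A j \<subseteq> space (p j)"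
    and B: "\<And>j z w. j < N \<Longrightarrow> z \<in> A j \<Longrightarrow> w \<in> A j \<Longrightarrow>
              (\<integral>\<^sup>+ \<theta>. ennreal \<bar>h \<theta> z - h \<theta> w\<bar> \<partial>Q) \<le> B j"
  shows "\<exists>z. (\<forall>j<N. z j \<in> A j) \<and>
           (\<integral>\<^sup>+ \<theta>. ennreal ((\<Sum>j<N. h \<theta> (z j) - (\<integral>w. h \<theta> w \<partial>p j))\<^sup>2) \<partial>Q) \<le> (\<Sum>j<N. B j)"
  using assms(2-)
proof (induction N)
  case 0
  then show ?case by simp
next
  case (Suc N)
  interpret Q: sigma_finite_measure Q by fact
  have "\<exists>z. (\<forall>j<N. z j \<in> A j) \<and>
           (\<integral>\<^sup>+ \<theta>. ennreal ((\<Sum>j<N. h \<theta> (z j) - (\<integral>w. h \<theta> w \<partial>p j))\<^sup>2) \<partial>Q) \<le> (\<Sum>j<N. B j)"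
    by (rule Suc.IH) (use Suc.prems in auto)
  then obtain z where z: "\<And>j. j < N \<Longrightarrow> z j \<in> A j" and
    le: "(\<integral>\<^sup>+ \<theta>. ennreal ((\<Sum>j<N. h \<theta> (z j) - (\<integral>w. h \<theta> w \<partial>p j))\<^sup>2) \<partial>Q) \<le> (\<Sum>j<N. B j)"
    by blast
  interpret pN: prob_space "p N" using Suc.prems by simp
  \<comment> \<open>The reference point for the averaging lemma has to come from the piece
    itself.\<close>
  have "A N \<noteq> {}"
  proof
    assume "A N = {}"
    then have "AE z in p N. False" using Suc.prems(5)[of N] by simp
    then show False by (simp add: pN.AE_False)
  qed
  then obtain z0 where z0: "z0 \<in> A N" by blast
  have G: "(\<lambda>\<theta>. \<Sum>j<N. h \<theta> (z j) - (\<integral>w. h \<theta> w \<partial>p j)) \<in> borel_measurable Q"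
  proof (intro borel_measurable_sum borel_measurable_diff)
    fix j assume j: "j \<in> {..<N}"
    then interpret pj: prob_space "p j" using Suc.prems by simp
    have m: "(\<lambda>(\<theta>, z). h \<theta> z) \<in> borel_measurable (Q \<Otimes>\<^sub>M p j)"
      using j Suc.prems(2) by simp
    then show "(\<lambda>\<theta>. \<integral>w. h \<theta> w \<partial>p j) \<in> borel_measurable Q"
      by (rule pj.borel_measurable_lebesgue_integral)
    have zj: "z j \<in> space (p j)"
      using z[of j] j Suc.prems(6)[of j] by auto
    show "(\<lambda>\<theta>. h \<theta> (z j)) \<in> borel_measurable Q"
      using measurable_compose[OF measurable_Pair2'[OF zj] m] by simp
  qed
  have "\<exists>w\<in>A N. (\<integral>\<^sup>+ \<theta>. ennreal (((\<Sum>j<N. h \<theta> (z j) - (\<integral>w. h \<theta> w \<partial>p j))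
            + (h \<theta> w - (\<integral>w. h \<theta> w \<partial>p N)))\<^sup>2) \<partial>Q)
      \<le> (\<integral>\<^sup>+ \<theta>. ennreal ((\<Sum>j<N. h \<theta> (z j) - (\<integral>w. h \<theta> w \<partial>p j))\<^sup>2) \<partial>Q) + B N"
    by (rule exists_point_square_integral_le[OF Q, where u = z0])
       (use Suc.prems(1-4,7) Suc.prems(5)[of N] Suc.prems(6)[of N] z0 G in auto)
  then obtain w where w: "w \<in> A N" and wle: "(\<integral>\<^sup>+ \<theta>. ennreal (((\<Sum>j<N. h \<theta> (z j) - (\<integral>w. h \<theta> w \<partial>p j))
            + (h \<theta> w - (\<integral>w. h \<theta> w \<partial>p N)))\<^sup>2) \<partial>Q)
      \<le> (\<integral>\<^sup>+ \<theta>. ennreal ((\<Sum>j<N. h \<theta> (z j) - (\<integral>w. h \<theta> w \<partial>p j))\<^sup>2) \<partial>Q) + B N"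
    by blast
  note wle
  also have "(\<integral>\<^sup>+ \<theta>. ennreal ((\<Sum>j<N. h \<theta> (z j) - (\<integral>w. h \<theta> w \<partial>p j))\<^sup>2) \<partial>Q) + B N \<le> (\<Sum>j<Suc N. B j)"
    using le by (simp add: add_right_mono)
  finally show ?case
    using z w by (intro exI[of _ "z(N := w)"]) (auto simp: less_Suc_eq)
qed

subsection \<open>Equal measure partitions\<close>

text \<open>Linearises the power of a diameter, so that the bounds for consecutive pieces can be
  summed by telescoping.\<close>

lemma powr_le_one_plus:
  fixes x p :: real
  assumes "0 \<le> x" "0 < p" "p \<le> 1"
  shows "x powr p \<le> 1 + x"
proof (cases "x \<le> 1")
  case True
  then have "x powr p \<le> 1 powr p" using assms by (intro powr_mono2) auto
  then show ?thesis using assms by simp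
next
  case False
  then have "x powr p \<le> x powr 1" using assms by (intro powr_mono) auto
  then show ?thesis using assms by simp
qed

lemma norm_le_coordinate_bounds:
  fixes x :: "real^'n" and \<delta> \<eta> :: real
  assumes "\<And>i. i \<noteq> k \<Longrightarrow> \<bar>x $ i\<bar> \<le> \<delta>" "\<bar>x $ k\<bar> \<le> \<eta>" "0 \<le> \<delta>"
  shows "norm x \<le> CARD('n) * \<delta> + \<eta>"
proof -
  have "norm x \<le> (\<Sum>i\<in>UNIV. \<bar>x $ i\<bar>)" by (rule norm_le_l1_cart)
  also have "\<dots> = \<bar>x $ k\<bar> + (\<Sum>i\<in>UNIV - {k}. \<bar>x $ i\<bar>)"
    by (simp add: sum.remove)
  also have "(\<Sum>i\<in>UNIV - {k}. \<bar>x $ i\<bar>) \<le> (\<Sum>i\<in>UNIV - {k}. \<delta>)"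
    by (rule sum_mono) (use assms in auto)
  also have "\<dots> \<le> (\<Sum>i\<in>(UNIV::'n set). \<delta>)"
    by (rule sum_mono2) (use assms in auto)
  finally show ?thesis using assms(2) by simp
qed

text \<open>The columns run in direction \<open>k\<close>, hence the exponent
  \<open>CARD('n) - 1\<close>. The index is real-valued so that a rescaled height can be added to
  it.\<close>

lemma exists_column_index:
  fixes k :: "'n::finite" and L :: real and m :: nat
  assumes "L > 0" "m > 0"
  shows "\<exists>g. g \<in> borel_measurable (borel :: (real^'n) measure) \<and>
     (\<forall>z. (\<forall>i. \<bar>z $ i\<bar> < L) \<longrightarrow> (\<exists>q < m ^ (CARD('n) - 1). g z = real q)) \<and>
     (\<forall>z w. (\<forall>i. \<bar>z $ i\<bar> < L) \<longrightarrow> (\<forall>i. \<bar>w $ i\<bar> < L) \<longrightarrow> g z = g w \<longrightarrow>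
        (\<forall>i. i \<noteq> k \<longrightarrow> \<bar>z $ i - w $ i\<bar> \<le> 2 * L / real m))"
proof -
  define cell :: "real^'n \<Rightarrow> 'n \<Rightarrow> nat"
    where "cell z i = nat \<lfloor>real m * (z $ i + L) / (2 * L)\<rfloor>" for z i
  define Col where "Col = (\<Pi>\<^sub>E i\<in>UNIV - {k}. {..<m})"
  have "finite Col" by (auto simp: Col_def intro!: finite_PiE)
  moreover have "card Col = m ^ (CARD('n) - 1)"
    by (simp add: Col_def card_PiE)
  \<comment> \<open>Any enumeration of the columns will do; consecutive numbers need not belong to
    adjacent columns.\<close>
  ultimately obtain e where e: "bij_betw e Col {..<m ^ (CARD('n) - 1)}"
    using ex_bij_betw_finite_nat[of Col] by (auto simp: atLeast0LessThan)
  \<comment> \<open>As a finite sum of products of indicators, \<open>g\<close> is visibly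
    measurable, also outside the box. Inside the box every product vanishes except that of the
    column containing \<open>z\<close>.\<close>
  define g where "g z = (\<Sum>c\<in>Col. real (e c) * (\<Prod>i\<in>UNIV-{k}. if cell z i = c i then 1 else 0))"
    for z :: "real^'n"
  have g_eq: "g z = real (e (restrict (cell z) (UNIV - {k})))" "restrict (cell z) (UNIV - {k}) \<in> Col"
    if z: "\<forall>i. \<bar>z $ i\<bar> < L" for z :: "real^'n"
  proof -
    let ?c = "restrict (cell z) (UNIV - {k})"
    have "cell z i < m" for i
    proof -
      have "z $ i + L < 2 * L" "0 < z $ i + L"
        using z[rule_format, of i] by (auto simp: abs_less_iff)
      then have "real m * (z $ i + L) < real m * (2 * L)"
        using assms by (intro mult_strict_left_mono) auto
      then have "real m * (z $ i + L) / (2 * L) < real m"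
        using assms by (simp add: pos_divide_less_eq)
      moreover have "0 \<le> real m * (z $ i + L) / (2 * L)"
        using assms \<open>0 < z $ i + L\<close> by simp
      ultimately show ?thesis unfolding cell_def
        by (subst nat_less_iff) (simp_all only: zero_le_floor floor_less_iff of_int_of_nat_eq)
    qed
    then show mem: "?c \<in> Col"
      unfolding Col_def by (intro restrict_PiE_iff[THEN iffD2] ballI) simp
    have "(\<Prod>i\<in>UNIV-{k}. if cell z i = c i then 1 else 0) = (if c = ?c then 1 else (0::real))"
      if c: "c \<in> Col" for c
    proof (cases "c = ?c")
      case False
      have "\<exists>i\<in>UNIV - {k}. c i \<noteq> cell z i"
      proof (rule ccontr)
        assume "\<not> ?thesis"
        then have "c = ?c"
          using c mem unfolding Col_def by (intro PiE_ext[where k="UNIV - {k}"]) auto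
        with False show False ..
      qed
      then obtain i where "i \<in> UNIV - {k}" "c i \<noteq> cell z i"
        by blast
      then have "\<exists>i\<in>UNIV-{k}. (if cell z i = c i then 1 else 0) = (0::real)"
        by (intro bexI[of _ i]) auto
      then have "(\<Prod>i\<in>UNIV-{k}. if cell z i = c i then 1 else 0) = (0::real)"
        by (intro prod_zero) auto
      with False show ?thesis by simp
    qed (auto intro!: prod.neutral)
    then have "g z = (\<Sum>c\<in>Col. real (e c) * (if c = ?c then 1 else 0))"
      unfolding g_def by (intro sum.cong) auto
    also have "\<dots> = real (e ?c)"
      using mem \<open>finite Col\<close> by (simp add: sum.delta if_distrib cong: if_cong)
    finally show "g z = real (e ?c)" .
  qed
  have "g \<in> borel_measurable borel"
    unfolding g_def cell_def by measurable
  moreover have "\<exists>q < m ^ (CARD('n) - 1). g z = real q" if z: "\<forall>i. \<bar>z $ i\<bar> < L" for z :: "real^'n"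
    using g_eq[OF z] bij_betwE[OF e] by (intro exI[of _ "e (restrict (cell z) (UNIV - {k}))"]) auto
  moreover have "\<bar>z $ i - w $ i\<bar> \<le> 2 * L / real m"
    if z: "\<forall>i. \<bar>z $ i\<bar> < L" and w: "\<forall>i. \<bar>w $ i\<bar> < L" and "g z = g w" "i \<noteq> k" for z w :: "real^'n" and i
  proof -
    have "e (restrict (cell z) (UNIV - {k})) = e (restrict (cell w) (UNIV - {k}))"
      using g_eq[OF z] g_eq[OF w] that by simp
    then have "restrict (cell z) (UNIV - {k}) = restrict (cell w) (UNIV - {k})"
      using g_eq[OF z] g_eq[OF w] e by (auto simp: bij_betw_def inj_on_def)
    then have "cell z i = cell w i"
      using \<open>i \<noteq> k\<close> by (auto dest!: fun_cong[where x=i])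
    moreover have "0 \<le> real m * (z $ i + L) / (2 * L)" "0 \<le> real m * (w $ i + L) / (2 * L)"
      using z[rule_format, of i] w[rule_format, of i] assms by (auto simp: abs_less_iff)
    ultimately have "\<lfloor>real m * (z $ i + L) / (2 * L)\<rfloor> = \<lfloor>real m * (w $ i + L) / (2 * L)\<rfloor>"
      by (simp add: cell_def eq_nat_nat_iff)
    then have "\<bar>real m * (z $ i + L) / (2 * L) - real m * (w $ i + L) / (2 * L)\<bar> < 1"
      by linarith
    also have "real m * (z $ i + L) / (2 * L) - real m * (w $ i + L) / (2 * L) = real m / (2 * L) * (z $ i - w $ i)"
      using assms by (simp add: field_simps)
    finally have "real m / (2 * L) * \<bar>z $ i - w $ i\<bar> < 1"
      using assms by (simp add: abs_mult)
    then show ?thesis using assms by (simp add: field_simps)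
  qed
  ultimately show ?thesis by blast
qed

text \<open>Without atoms the distribution function is continuous, so the intermediate value theorem
  supplies every quantile.\<close>

lemma cdf_surj_on:
  assumes "real_distribution D" "\<And>x. measure D {x} = 0" "cdf D 0 = 0" "cdf D K = 1" "0 \<le> K" "0 \<le> y" "y \<le> 1"
  shows "\<exists>t. 0 \<le> t \<and> t \<le> K \<and> cdf D t = y"
proof -
  interpret real_distribution D by fact
  show ?thesis
    by (rule IVT) (use assms isCont_cdf in auto)
qed

lemma emeasure_coordinate_hyperplane:
  fixes k :: "'n::finite"
  shows "emeasure lborel {z :: real^'n. z $ k = a} = 0"
proof -
  have "negligible {z :: real^'n. z $ k = a}"
    using negligible_standard_hyperplane[of "axis k (1::real)" a]
    by (simp add: cart_eq_inner_axis[symmetric] axis_in_Basis_iff)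
  then have "emeasure lebesgue {z :: real^'n. z $ k = a} = 0"
    by (simp add: negligible_iff_emeasure0 negligible_imp_measurable)
  moreover have "{z :: real^'n. z $ k = a} \<in> sets lborel"
    by simp
  ultimately show ?thesis by (simp add: emeasure_completion)
qed

text \<open>\<open>m\<close> is \<open>N powr (1 / d)\<close> rounded up, which at most doubles a
  number that is at least 1. The three bounds serve for the total height of all columns counted in
  cells, for the number of columns, and for the scale of a cell.\<close>

lemma exists_grid_size:
  fixes N d :: nat and \<beta> :: real
  assumes "N > 0" "d > 0" "0 < \<beta>" "\<beta> \<le> 1"
  shows "\<exists>m::nat. m > 0 \<and> real (m ^ d) \<le> 2 ^ d * real N \<and>
     real (m ^ (d - 1)) \<le> 2 ^ d * real N * real m powr - \<beta> \<and>
     real m powr - \<beta> \<le> real N powr (- \<beta> / real d)"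
proof -
  let ?s = "real N powr (1 / real d)"
  define m where "m = nat \<lceil>?s\<rceil>"
  have s1: "1 \<le> ?s"
    using assms by (intro ge_one_powr_ge_zero) auto
  have sm: "?s \<le> real m" "real m \<le> 2 * ?s"
    unfolding m_def using s1 by linarith+
  have m0: "m > 0" and m1: "1 \<le> real m"
    using s1 sm by linarith+
  have "?s ^ d = real N"
    using assms by (simp add: powr_realpow[symmetric] powr_powr)
  moreover have "real m ^ d \<le> (2 * ?s) ^ d"
    using sm by (intro power_mono) auto
  ultimately have md: "real (m ^ d) \<le> 2 ^ d * real N"
    by (simp add: power_mult_distrib)
  have "real m * real (m ^ (d - 1)) = real (m ^ d)"
    using assms by (cases d) auto
  then have "real (m ^ (d - 1)) = real (m ^ d) * real m powr - 1"
    using m0 by (simp add: powr_minus field_simps)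
  \<comment> \<open>Here \<open>\<beta> \<le> 1\<close> enters: as \<open>m\<close> is at least 1,
    \<open>m powr - 1\<close> is at most \<open>m powr - \<beta>\<close>.\<close>
  also have "\<dots> \<le> (2 ^ d * real N) * real m powr - \<beta>"
    using md m1 assms by (intro mult_mono powr_mono) auto
  finally have K: "real (m ^ (d - 1)) \<le> 2 ^ d * real N * real m powr - \<beta>" .
  have "real m powr - \<beta> \<le> ?s powr - \<beta>"
    using s1 sm assms by (intro powr_mono2') auto
  also have "\<dots> = real N powr (- \<beta> / real d)"
    by (simp add: powr_powr)
  finally show ?thesis
    using m0 md K by blast
qed

text \<open>The pieces are cut at the quantiles of a single real function that encodes column and
  height, so their measures agree exactly whatever the shape of \<open>E\<close>. The individual
  \<open>r j\<close> may be large; only their sum is controlled.\<close>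

lemma exists_equal_measure_partition:
  fixes E :: "(real^'n) set" and \<beta> :: real
  assumes E[measurable]: "E \<in> sets borel" and bdd: "bounded E" and pos: "0 < measure lborel E"
    and \<beta>: "0 < \<beta>" "\<beta> \<le> 1"
  shows "\<exists>C>0. \<forall>N>0. \<exists>A r.
     (\<forall>j<N. A j \<in> sets borel \<and> A j \<subseteq> E \<and> measure lborel (A j) = measure lborel E / real N) \<and>
     disjoint_family_on A {..<N} \<and>
     (\<forall>j<N. \<forall>z\<in>A j. \<forall>w\<in>A j. norm (z - w) powr \<beta> \<le> r j) \<and>
     (\<Sum>j<N. r j) \<le> C * real N powr (1 - \<beta> / real CARD('n))"
proof -
  let ?d = "CARD('n)"
  obtain B where B: "\<And>z. z \<in> E \<Longrightarrow> norm z \<le> B" "B > 0"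
    using bdd by (auto simp: bounded_pos)
  \<comment> \<open>The extra 1 makes the coordinate bounds strict, so that rescaled heights lie
    strictly between 0 and 1.\<close>
  define L where "L = B + 1"
  have zL: "\<bar>z $ i\<bar> < L" if "z \<in> E" for z i
    using B(1)[OF that] component_le_norm_cart[of z i] by (simp add: L_def)
  have L: "L > 0" using B by (simp add: L_def)
  \<comment> \<open>Any coordinate can serve as the height; \<open>undefined\<close> is just some
    element of the index type.\<close>
  define k :: 'n where "k = undefined"
  have finE: "emeasure lborel E < \<infinity>"
    using emeasure_bounded_finite[OF bdd] .
  have emE: "emeasure lborel E \<noteq> 0"
    using pos by (auto simp: measure_def)
  have d0: "?d > 0" by simp
  \<comment> \<open>By \<open>powr_le_one_plus\<close>, \<open>M\<close> bounds the
    \<open>\<beta>\<close>-th power of the distance of any two points of \<open>E\<close>. The three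
    terms of \<open>C\<close> come from the width of the cells, the heights of the pieces, and the
    pieces that straddle columns.\<close>
  define M where "M = 1 + 2 * L * real ?d"
  have M: "M > 0" using L by (simp add: M_def add_pos_nonneg)
  define C where "C = M + 2 * L * 2 ^ ?d + M * 2 ^ ?d"
  have "C > 0" using M L by (simp add: C_def add_pos_pos)
  moreover have "\<exists>A r.
     (\<forall>j<N. A j \<in> sets borel \<and> A j \<subseteq> E \<and> measure lborel (A j) = measure lborel E / real N) \<and>
     disjoint_family_on A {..<N} \<and>
     (\<forall>j<N. \<forall>z\<in>A j. \<forall>w\<in>A j. norm (z - w) powr \<beta> \<le> r j) \<and>
     (\<Sum>j<N. r j) \<le> C * real N powr (1 - \<beta> / real ?d)" if N: "N > 0" for N :: nat
  proof -
    obtain m where m: "m > 0" "real (m ^ ?d) \<le> 2 ^ ?d * real N"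
      "real (m ^ (?d - 1)) \<le> 2 ^ ?d * real N * real m powr - \<beta>"
      "real m powr - \<beta> \<le> real N powr (- \<beta> / real ?d)"
      using exists_grid_size[OF N d0 \<beta>] by blast
    define K where "K = real (m ^ (?d - 1))"
    have mK: "real m * K = real (m ^ ?d)"
      unfolding K_def using d0 by (cases ?d) auto
    obtain g where g[measurable]: "g \<in> borel_measurable (borel :: (real^'n) measure)"
      and g_nat: "\<And>z. (\<And>i. \<bar>z $ i\<bar> < L) \<Longrightarrow> \<exists>q < m ^ (?d - 1). g z = real q"
      and g_col: "\<And>z w i. (\<And>i. \<bar>z $ i\<bar> < L) \<Longrightarrow> (\<And>i. \<bar>w $ i\<bar> < L) \<Longrightarrow> g z = g w \<Longrightarrow> i \<noteq> k \<Longrightarrow>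
        \<bar>z $ i - w $ i\<bar> \<le> 2 * L / real m"
      using exists_column_index[OF L m(1), of k] by metis
    \<comment> \<open>On \<open>E\<close> the integer part of \<open>\<phi>\<close> is the column
      number and the fractional part the rescaled height, so ordering by \<open>\<phi>\<close> means
      ordering by column and then by height.\<close>
    define \<phi> where "\<phi> z = g z + (z $ k + L) / (2 * L)" for z
    have [measurable]: "\<phi> \<in> borel_measurable borel"
      unfolding \<phi>_def by measurable
    have frac: "0 < (z $ k + L) / (2 * L)" "(z $ k + L) / (2 * L) < 1" if "z \<in> E" for z
      using zL[OF that, of k] L by (auto simp: abs_less_iff)
    have floor_\<phi>: "of_int \<lfloor>\<phi> z\<rfloor> = g z" and \<phi>_bound: "0 < \<phi> z" "\<phi> z \<le> K" if z: "z \<in> E" for z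
    proof -
      obtain q where q: "q < m ^ (?d - 1)" "g z = real q"
        using g_nat[of z] zL[OF z] by blast
      have "\<lfloor>\<phi> z\<rfloor> = int q"
        using frac[OF z] unfolding \<phi>_def q by (intro floor_unique) auto
      then show "of_int \<lfloor>\<phi> z\<rfloor> = g z" using q by simp
      show "0 < \<phi> z" using frac[OF z] unfolding \<phi>_def q by (intro add_nonneg_pos) auto
      have "real q + 1 \<le> K"
        unfolding K_def using q(1) by linarith
      then show "\<phi> z \<le> K" using frac[OF z] unfolding \<phi>_def q by simp
    qed
    let ?U = "uniform_measure lborel E"
    interpret U: prob_space ?U
      using emE finE by (intro prob_space_uniform_measure) auto
    define D where "D = distr ?U borel \<phi>"
    interpret D: real_distribution D
      unfolding D_def by (rule U.real_distribution_distr) simp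
    have measure_D: "measure D S = measure lborel (E \<inter> \<phi> -` S) / measure lborel E"
      if [measurable]: "S \<in> sets borel" for S
    proof -
      have S': "\<phi> -` S \<in> sets lborel"
        using measurable_sets[of \<phi> lborel borel S] by simp
      then have "measure D S = measure ?U (\<phi> -` S)"
        unfolding D_def by (subst measure_distr) auto
      also have "\<dots> = measure lborel (E \<inter> \<phi> -` S) / measure lborel E"
        using S' emE finE by (intro measure_uniform_measure) auto
      finally show ?thesis .
    qed
    have cdf: "cdf D t = measure lborel (E \<inter> {z. \<phi> z \<le> t}) / measure lborel E" for t
      by (simp add: cdf_def2 measure_D vimage_def)
    have "measure D {x} = 0" for x
    proof -
      \<comment> \<open>Once the column is known, the value of \<open>\<phi>\<close> determines the
        height, so a level set lies in one hyperplane per column.\<close>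
      have "E \<inter> \<phi> -` {x} \<subseteq> (\<Union>q<m ^ (?d - 1). {z. z $ k = 2 * L * (x - real q) - L})"
      proof
        fix z assume z: "z \<in> E \<inter> \<phi> -` {x}"
        then obtain q where q: "q < m ^ (?d - 1)" "g z = real q"
          using g_nat[of z] zL[of z] by blast
        have "z $ k = 2 * L * (x - real q) - L"
          using z L q(2) unfolding \<phi>_def by (auto simp: field_simps)
        with q show "z \<in> (\<Union>q<m ^ (?d - 1). {z. z $ k = 2 * L * (x - real q) - L})"
          by blast
      qed
      moreover have "(\<Union>q<m ^ (?d - 1). {z. z $ k = 2 * L * (x - real q) - L}) \<in> null_sets lborel"
        by (intro null_sets_UN' countable_finite) (auto simp: null_sets_def emeasure_coordinate_hyperplane)
      ultimately have "E \<inter> \<phi> -` {x} \<in> null_sets lborel"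
        by (rule null_sets_subset[rotated 2]) auto
      then show ?thesis
        by (subst measure_D) (simp_all add: null_sets_def measure_eq_emeasure_eq_ennreal[where x=0])
    qed
    moreover have "cdf D 0 = 0"
    proof -
      have "E \<inter> {z. \<phi> z \<le> 0} = {}" using \<phi>_bound by force
      then show ?thesis by (simp add: cdf)
    qed
    moreover have "cdf D K = 1"
    proof -
      have "E \<inter> {z. \<phi> z \<le> K} = E" using \<phi>_bound by force
      then show ?thesis using pos by (simp add: cdf)
    qed
    ultimately have "\<exists>t. 0 \<le> t \<and> t \<le> K \<and> cdf D t = real j / real N" if "j \<le> N" for j
      using that N by (intro cdf_surj_on D.real_distribution_axioms) (auto simp: K_def)
    then obtain t where t: "\<And>j. j \<le> N \<Longrightarrow> 0 \<le> t j \<and> t j \<le> K \<and> cdf D (t j) = real j / real N"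
      by metis
    \<comment> \<open>The cut points were chosen independently of each other. Their order is
      recovered from the values of the distribution function, which increase strictly with
      \<open>j\<close>.\<close>
    have t_mono: "t i \<le> t j" if "i \<le> j" "j \<le> N" for i j
    proof (rule ccontr)
      assume "\<not> t i \<le> t j"
      then have "cdf D (t j) \<le> cdf D (t i)" by (intro D.cdf_nondecreasing) simp
      then have "real j / real N \<le> real i / real N" using t that by simp
      then have "j \<le> i" using N by (simp add: divide_le_cancel)
      with that \<open>\<not> t i \<le> t j\<close> show False by simp
    qed
    \<comment> \<open>Half-open intervals make the pieces disjoint. Points with
      \<open>\<phi> z \<le> t 0\<close> belong to no piece, so \<open>E\<close> is exhausted only up
      to a null set.\<close>
    define A where "A j = E \<inter> {z. t j < \<phi> z \<and> \<phi> z \<le> t (Suc j)}" for j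
    \<comment> \<open>A piece inside one column has diameter of order \<open>1 / m + t (Suc j) - t j\<close>; a piece meeting
      several columns makes the floor of the cut point jump. Both contributions telescope.\<close>
    define r where "r j = real m powr - \<beta> * (M + 2 * L * real m * (t (Suc j) - t j))
        + M * (of_int \<lfloor>t (Suc j)\<rfloor> - of_int \<lfloor>t j\<rfloor>)" for j
    have A_sets: "A j \<in> sets borel" for j
      unfolding A_def by measurable
    have A_measure: "measure lborel (A j) = measure lborel E / real N" if j: "j < N" for j
    proof -
      have "A j = (E \<inter> {z. \<phi> z \<le> t (Suc j)}) - (E \<inter> {z. \<phi> z \<le> t j})"
        by (auto simp: A_def)
      moreover have "measure lborel ((E \<inter> {z. \<phi> z \<le> t (Suc j)}) - (E \<inter> {z. \<phi> z \<le> t j})) =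
          measure lborel (E \<inter> {z. \<phi> z \<le> t (Suc j)}) - measure lborel (E \<inter> {z. \<phi> z \<le> t j})"
      proof (rule measure_Diff)
        have "emeasure lborel (E \<inter> {z. \<phi> z \<le> t (Suc j)}) \<le> emeasure lborel E"
          by (rule emeasure_mono) auto
        then show "emeasure lborel (E \<inter> {z. \<phi> z \<le> t (Suc j)}) \<noteq> \<infinity>"
          using finE by (auto simp: top_unique)
        show "E \<inter> {z. \<phi> z \<le> t j} \<subseteq> E \<inter> {z. \<phi> z \<le> t (Suc j)}"
          using t_mono[of j "Suc j"] j by auto
      qed simp_all
      ultimately have "measure lborel (A j) = measure lborel E * (cdf D (t (Suc j)) - cdf D (t j))"
        using pos by (simp add: cdf diff_divide_distrib[symmetric])
      also have "cdf D (t (Suc j)) - cdf D (t j) = 1 / real N"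
        using t[of j] t[of "Suc j"] j by (simp add: diff_divide_distrib[symmetric])
      finally show ?thesis by simp
    qed
    have "disjoint_family_on A {..<N}"
      unfolding disjoint_family_on_def
    proof (intro ballI impI)
      have *: "A i \<inter> A j = {}" if "i < j" "j < N" for i j
        using t_mono[of "Suc i" j] that by (force simp: A_def)
      fix i j assume "i \<in> {..<N}" "j \<in> {..<N}" "i \<noteq> j"
      then show "A i \<inter> A j = {}"
        using *[of i j] *[of j i] by (cases i j rule: linorder_cases) auto
    qed
    moreover have "norm (z - w) powr \<beta> \<le> r j" if j: "j < N" and z: "z \<in> A j" and w: "w \<in> A j" for j z w
    proof -
      have zE: "z \<in> E" and wE: "w \<in> E" using z w by (auto simp: A_def)
      have tj: "t j \<le> t (Suc j)" using t_mono[of j "Suc j"] j by simp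
      have fl: "\<lfloor>t j\<rfloor> \<le> \<lfloor>t (Suc j)\<rfloor>" using tj by (rule floor_mono)
      show ?thesis
      proof (cases "g z = g w")
        case True
        have "z $ k - w $ k = 2 * L * (\<phi> z - \<phi> w)"
          using L True by (simp add: \<phi>_def field_simps)
        then have "\<bar>z $ k - w $ k\<bar> = 2 * L * \<bar>\<phi> z - \<phi> w\<bar>"
          using L by (simp add: abs_mult)
        also have "\<dots> \<le> 2 * L * (t (Suc j) - t j)"
          using L z w by (intro mult_left_mono) (auto simp: A_def)
        finally have "norm (z - w) \<le> real ?d * (2 * L / real m) + 2 * L * (t (Suc j) - t j)"
          using g_col[of z w] zL[OF zE] zL[OF wE] True L
          by (intro norm_le_coordinate_bounds[where k=k]) auto
        \<comment> \<open>The cell scale is pulled out before the power is linearised; this keeps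
          the factor \<open>m powr - \<beta>\<close> in front of the whole bound.\<close>
        also have "\<dots> = inverse (real m) * (2 * L * real ?d + 2 * L * real m * (t (Suc j) - t j))"
          using m(1) by (simp add: field_simps)
        finally have "norm (z - w) powr \<beta> \<le> (inverse (real m) * (2 * L * real ?d + 2 * L * real m * (t (Suc j) - t j))) powr \<beta>"
          using \<beta> by (intro powr_mono2) auto
        also have "\<dots> = real m powr - \<beta> * (2 * L * real ?d + 2 * L * real m * (t (Suc j) - t j)) powr \<beta>"
          using m(1) L tj by (subst powr_mult) (auto simp: powr_minus inverse_powr)
        also have "\<dots> \<le> real m powr - \<beta> * (1 + (2 * L * real ?d + 2 * L * real m * (t (Suc j) - t j)))"
          using L tj \<beta> by (intro mult_left_mono powr_le_one_plus) auto
        also have "\<dots> \<le> r j"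
        proof -
          have "0 \<le> M * (of_int \<lfloor>t (Suc j)\<rfloor> - of_int \<lfloor>t j\<rfloor>)"
            using M fl by (intro mult_nonneg_nonneg) auto
          then show ?thesis by (simp add: r_def M_def add_ac)
        qed
        finally show ?thesis .
      next
        case False
        have "\<bar>(z - w) $ i\<bar> \<le> 2 * L" for i
          using zL[OF zE, of i] zL[OF wE, of i] by simp
        then have "norm (z - w) \<le> (\<Sum>i\<in>(UNIV::'n set). 2 * L)"
          by (intro order_trans[OF norm_le_l1_cart] sum_mono)
        then have "norm (z - w) \<le> 2 * L * real ?d" by (simp add: mult.commute)
        then have "norm (z - w) powr \<beta> \<le> M"
          using powr_le_one_plus[of "norm (z - w)" \<beta>] \<beta> by (simp add: M_def)
        also have "M * 1 \<le> M * (of_int \<lfloor>t (Suc j)\<rfloor> - of_int \<lfloor>t j\<rfloor>)"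
        proof (rule mult_left_mono)
          \<comment> \<open>The two column numbers differ, and both lie between the floors of the
            cut points, so these floors differ by at least 1.\<close>
          have "\<lfloor>\<phi> z\<rfloor> \<noteq> \<lfloor>\<phi> w\<rfloor>"
            using False floor_\<phi>[OF zE] floor_\<phi>[OF wE] by auto
          moreover have "\<lfloor>t j\<rfloor> \<le> \<lfloor>\<phi> z\<rfloor>" "\<lfloor>t j\<rfloor> \<le> \<lfloor>\<phi> w\<rfloor>" "\<lfloor>\<phi> z\<rfloor> \<le> \<lfloor>t (Suc j)\<rfloor>" "\<lfloor>\<phi> w\<rfloor> \<le> \<lfloor>t (Suc j)\<rfloor>"
            using z w by (auto simp: A_def intro!: floor_mono)
          ultimately have "1 \<le> \<lfloor>t (Suc j)\<rfloor> - \<lfloor>t j\<rfloor>" by linarith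
          then show "1 \<le> of_int \<lfloor>t (Suc j)\<rfloor> - (of_int \<lfloor>t j\<rfloor> :: real)"
            by linarith
        qed (use M in simp)
        finally have "norm (z - w) powr \<beta> \<le> M * (of_int \<lfloor>t (Suc j)\<rfloor> - of_int \<lfloor>t j\<rfloor>)" by simp
        moreover have "0 \<le> real m powr - \<beta> * (M + 2 * L * real m * (t (Suc j) - t j))"
          using L M tj by simp
        ultimately show ?thesis by (simp add: r_def)
      qed
    qed
    moreover have "(\<Sum>j<N. r j) \<le> C * real N powr (1 - \<beta> / real ?d)"
    proof -
      let ?p = "real m powr - \<beta>"
      have "(\<Sum>j<N. r j) = ?p * (M * real N + 2 * L * real m * (\<Sum>j<N. t (Suc j) - t j))
          + M * (\<Sum>j<N. of_int \<lfloor>t (Suc j)\<rfloor> - of_int \<lfloor>t j\<rfloor>)"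
        unfolding r_def sum.distrib sum_distrib_left[symmetric] by simp
      also have "\<dots> = ?p * (M * real N + 2 * L * real m * (t N - t 0)) + M * (of_int \<lfloor>t N\<rfloor> - of_int \<lfloor>t 0\<rfloor>)"
        using sum_lessThan_telescope[of "\<lambda>j. real_of_int \<lfloor>t j\<rfloor>" N] by (simp add: sum_lessThan_telescope)
      also have "\<dots> \<le> ?p * (M * real N + 2 * L * real m * K) + M * K"
      proof -
        have "t N \<le> K" "0 \<le> t 0" using t[of 0] t[of N] by auto
        moreover from this have "of_int \<lfloor>t N\<rfloor> - of_int \<lfloor>t 0\<rfloor> \<le> K"
          by (smt (verit) of_int_floor_le zero_le_floor of_int_0_le_iff)
        ultimately show ?thesis
          using M L by (intro add_mono mult_left_mono) auto
      qed
      also have "\<dots> = ?p * (M * real N + 2 * L * (real m * K)) + M * K"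
        by simp
      also have "\<dots> \<le> ?p * (M * real N + 2 * L * (2 ^ ?d * real N)) + M * (2 ^ ?d * real N * ?p)"
        using m(2,3) M L unfolding mK unfolding K_def by (intro add_mono mult_left_mono) auto
      also have "\<dots> = C * real N * ?p"
        by (simp add: C_def algebra_simps)
      also have "\<dots> \<le> C * real N * real N powr (- \<beta> / real ?d)"
        using m(4) \<open>C > 0\<close> by (intro mult_left_mono) auto
      also have "\<dots> = C * real N powr (1 - \<beta> / real ?d)"
        using N powr_add[of "real N" 1 "- \<beta> / real ?d"] by simp
      finally show ?thesis .
    qed
    ultimately show ?thesis
      using A_sets A_measure by (intro exI[of _ A] exI[of _ r]) (auto simp: A_def)
  qed
  ultimately show ?thesis by blast
qed

subsection \<open>Motions separating two points\<close>

text \<open>The segment from \<open>u\<close> to \<open>u + v\<close> joins a point of the set to a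
  point outside it, hence meets the frontier.\<close>

lemma infdist_frontier_le:
  fixes u v :: "'a::euclidean_space"
  assumes "(u \<in> \<Omega>) \<noteq> (u + v \<in> \<Omega>)"
  shows "infdist u (frontier \<Omega>) \<le> norm v"
proof -
  have "closed_segment u (u + v) \<inter> frontier \<Omega> \<noteq> {}"
    using assms by (intro connected_Int_frontier) auto
  then obtain y where y: "y \<in> closed_segment u (u + v)" "y \<in> frontier \<Omega>"
    by blast
  have "infdist u (frontier \<Omega>) \<le> dist u y"
    using y(2) by (rule infdist_le)
  also have "\<dots> \<le> norm v"
    using segment_bound1[OF y(1)] by (simp add: dist_norm norm_minus_commute)
  finally show ?thesis .
qed

text \<open>For a short nonzero \<open>v\<close> the set lies in the neighbourhood of the frontier
  of width \<open>norm v\<close>. For \<open>norm v\<close> at least 1 the boundary hypothesis says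
  nothing, but twice the measure of the body suffices because \<open>norm v powr \<beta>\<close> is
  then at least 1.\<close>

lemma emeasure_translation_difference_le:
  fixes \<Omega> :: "'a::euclidean_space set" and \<beta> c :: real
  assumes \<Omega>[measurable]: "\<Omega> \<in> sets borel" and bdd: "bounded \<Omega>" and \<beta>: "0 < \<beta>" and c: "0 < c"
    and bdry: "\<And>t. 0 < t \<Longrightarrow> t < 1 \<Longrightarrow>
      emeasure lebesgue {z. infdist z (frontier \<Omega>) \<le> t} \<le> ennreal (c * t powr \<beta>)"
  shows "emeasure lborel {u. (u \<in> \<Omega>) \<noteq> (u + v \<in> \<Omega>)}
     \<le> ennreal ((c + 2 * measure lborel \<Omega>) * norm v powr \<beta>)" (is "emeasure lborel ?S \<le> _")
proof -
  have S[measurable]: "?S \<in> sets borel" by measurable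
  consider "v = 0" | "0 < norm v" "norm v < 1" | "1 \<le> norm v"
    by force
  then show ?thesis
  proof cases
    case 1
    then show ?thesis by simp
  next
    case 2
    have "closed {z. infdist z (frontier \<Omega>) \<le> norm v}"
      by (intro closed_Collect_le continuous_intros)
    then have [measurable]: "{z. infdist z (frontier \<Omega>) \<le> norm v} \<in> sets borel"
      by simp
    have "emeasure lborel ?S \<le> emeasure lborel {z. infdist z (frontier \<Omega>) \<le> norm v}"
      using infdist_frontier_le[of _ \<Omega> v] by (intro emeasure_mono) auto
    also have "\<dots> = emeasure lebesgue {z. infdist z (frontier \<Omega>) \<le> norm v}"
      by (simp add: emeasure_completion)
    also have "\<dots> \<le> ennreal (c * norm v powr \<beta>)"
      using 2 by (rule bdry)
    also have "\<dots> \<le> ennreal ((c + 2 * measure lborel \<Omega>) * norm v powr \<beta>)"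
      by (intro ennreal_leI mult_right_mono) auto
    finally show ?thesis .
  next
    case 3
    have fin: "emeasure lborel \<Omega> = ennreal (measure lborel \<Omega>)"
      using emeasure_bounded_finite[OF bdd] by (intro emeasure_eq_ennreal_measure) auto
    have "emeasure lborel ?S \<le> emeasure lborel (\<Omega> \<union> (\<lambda>u. v + u) -` \<Omega>)"
      using measurable_sets[of "\<lambda>u. v + u" lborel borel \<Omega>]
      by (intro emeasure_mono) (auto simp: add.commute)
    also have "\<dots> \<le> emeasure lborel \<Omega> + emeasure lborel ((\<lambda>u. v + u) -` \<Omega>)"
      using measurable_sets[of "\<lambda>u. v + u" lborel borel \<Omega>]
      by (intro emeasure_subadditive) auto
    also have "emeasure lborel ((\<lambda>u. v + u) -` \<Omega>) = emeasure (distr lborel borel ((+) v)) \<Omega>"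
      by (simp add: emeasure_distr)
    also have "\<dots> = emeasure lborel \<Omega>"
      by (simp add: lborel_distr_plus)
    also have "emeasure lborel \<Omega> + emeasure lborel \<Omega> = ennreal (2 * measure lborel \<Omega> * 1)"
      by (simp add: fin flip: ennreal_plus)
    also have "\<dots> \<le> ennreal ((c + 2 * measure lborel \<Omega>) * norm v powr \<beta>)"
      using 3 \<beta> c by (intro ennreal_leI mult_mono) (auto intro: ge_one_powr_ge_zero)
    finally show ?thesis .
  qed
qed

section \<open>Lebesgue measure under translations, orthogonal maps and similarities\<close>

lemma nn_integral_lborel_translation:
  fixes f :: "'a::euclidean_space \<Rightarrow> ennreal"
  assumes "f \<in> borel_measurable borel"
  shows "(\<integral>\<^sup>+ x. f (c + x) \<partial>lborel) = (\<integral>\<^sup>+ x. f x \<partial>lborel)"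
proof -
  have "(\<integral>\<^sup>+ x. f x \<partial>lborel) = (\<integral>\<^sup>+ x. f x \<partial>distr lborel borel ((+) c))"
    by (simp add: lborel_distr_plus)
  also have "\<dots> = (\<integral>\<^sup>+ x. f (c + x) \<partial>lborel)"
    using assms by (intro nn_integral_distr) auto
  finally show ?thesis ..
qed

text \<open>\<open>measure_orthogonal_image\<close> needs a well-ordered index type. Here translation invariance and
  Fubini give \<open>|T\<^sup>-\<^sup>1 A| |B| = |B| |A|\<close> for the unit ball \<open>B\<close>, which satisfies \<open>T\<^sup>-\<^sup>1 (- B) = B\<close>.\<close>

lemma emeasure_lborel_orthogonal_vimage:
  fixes T :: "'a::euclidean_space \<Rightarrow> 'a"
  assumes T: "orthogonal_transformation T" and A[measurable]: "A \<in> sets borel"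
  shows "emeasure lborel (T -` A) = emeasure lborel A"
proof -
  have lin: "linear T" and bij: "bij T"
    using T by (auto intro: orthogonal_transformation_linear orthogonal_transformation_bij)
  have [measurable]: "T \<in> borel_measurable borel"
    using lin by (intro borel_measurable_continuous_onI linear_continuous_on linear_conv_bounded_linear[THEN iffD1])
  define B :: "'a set" where "B = ball 0 1"
  have B: "emeasure lborel B \<noteq> 0" "emeasure lborel B \<noteq> \<infinity>"
    unfolding B_def by (simp_all add: emeasure_ball less_imp_neq[OF unit_ball_vol_pos, symmetric])
  have [measurable]: "B \<in> sets borel" by (simp add: B_def)
  have "emeasure lborel (T -` A) * emeasure lborel B
      = (\<integral>\<^sup>+ x. (\<integral>\<^sup>+ y. indicator A (T x) * indicator B y \<partial>lborel) \<partial>lborel)"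
  proof -
    have "T -` A \<in> sets borel"
      using measurable_sets[of T borel borel A] by simp
    then have "emeasure lborel (T -` A) = (\<integral>\<^sup>+ x. indicator A (T x) \<partial>lborel)"
      by (simp add: indicator_vimage[symmetric] flip: nn_integral_indicator)
    then show ?thesis
      by (simp add: nn_integral_cmult nn_integral_multc)
  qed
  also have "\<dots> = (\<integral>\<^sup>+ x. (\<integral>\<^sup>+ y. indicator A (T x) * indicator B (- T x + y) \<partial>lborel) \<partial>lborel)"
    by (intro nn_integral_cong nn_integral_lborel_translation[symmetric]) measurable
  also have "\<dots> = (\<integral>\<^sup>+ y. (\<integral>\<^sup>+ x. indicator A (T x) * indicator B (- T x + y) \<partial>lborel) \<partial>lborel)"
    by (rule lborel_pair.Fubini') measurable
  \<comment> \<open>Shifting \<open>x\<close> by \<open>inv T y\<close> moves \<open>y\<close> from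
    the argument of \<open>B\<close> to that of \<open>A\<close>: the former becomes
    \<open>- T x\<close>, and the ball does not distinguish it from \<open>x\<close>.\<close>
  also have "\<dots> = (\<integral>\<^sup>+ y. (\<integral>\<^sup>+ x. indicator A (T (inv T y + x)) * indicator B (- T (inv T y + x) + y) \<partial>lborel) \<partial>lborel)"
    by (intro nn_integral_cong nn_integral_lborel_translation[symmetric]) measurable
  also have "\<dots> = (\<integral>\<^sup>+ y. (\<integral>\<^sup>+ x. indicator A (T x + y) * indicator B x \<partial>lborel) \<partial>lborel)"
  proof (intro nn_integral_cong)
    fix x y :: 'a
    have "T (inv T y + x) = T x + y"
      using bij by (simp add: linear_add[OF lin] bij_is_surj surj_f_inv_f)
    moreover have "(- T x \<in> B) = (x \<in> B)"
      using T by (simp add: B_def orthogonal_transformation_norm)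
    ultimately show "indicator A (T (inv T y + x)) * indicator B (- T (inv T y + x) + y)
        = (indicator A (T x + y) * indicator B x :: ennreal)"
      by (simp add: indicator_def)
  qed
  also have "\<dots> = (\<integral>\<^sup>+ x. (\<integral>\<^sup>+ y. indicator A (T x + y) * indicator B x \<partial>lborel) \<partial>lborel)"
    by (rule lborel_pair.Fubini') measurable
  also have "\<dots> = (\<integral>\<^sup>+ x. (\<integral>\<^sup>+ y. indicator A y * indicator B x \<partial>lborel) \<partial>lborel)"
    by (intro nn_integral_cong nn_integral_lborel_translation[where f="\<lambda>y. indicator A y * indicator B _"]) measurable
  also have "\<dots> = emeasure lborel A * emeasure lborel B"
    by (simp add: nn_integral_cmult nn_integral_multc)
  finally show ?thesis
    using B by (subst (asm) (1 2) mult.commute) (simp add: ennreal_mult_cancel_left)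
qed

text \<open>The image under an orthogonal matrix is the preimage under its transpose, which also
  shows that it is Borel. Negative factors are allowed because the factor \<open>- \<tau>\<close>
  occurs below.\<close>

lemma emeasure_similarity_image:
  fixes S :: "(real^'n) set"
  assumes \<sigma>: "orthogonal_matrix \<sigma>" and S: "S \<in> sets borel"
  shows "emeasure lebesgue ((\<lambda>u. c *\<^sub>R (\<sigma> *v u) + z) ` S) = ennreal (\<bar>c\<bar> ^ CARD('n)) * emeasure lborel S"
proof -
  have T: "orthogonal_transformation ((*v) (transpose \<sigma>))"
    using \<sigma> by (simp add: orthogonal_transformation_matrix)
  have inv: "transpose \<sigma> *v (\<sigma> *v u) = u" "\<sigma> *v (transpose \<sigma> *v u) = u" for u
    using \<sigma> by (simp_all add: orthogonal_matrix_def matrix_vector_mul_assoc del: transpose_matrix_vector)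
  have "(*v) \<sigma> ` S = (*v) (transpose \<sigma>) -` S"
  proof (intro set_eqI iffI)
    fix x assume "x \<in> (*v) \<sigma> ` S"
    then show "x \<in> (*v) (transpose \<sigma>) -` S"
      using inv(1) by (auto simp del: transpose_matrix_vector)
  next
    fix x assume "x \<in> (*v) (transpose \<sigma>) -` S"
    then show "x \<in> (*v) \<sigma> ` S"
      using inv(2)[of x, symmetric] by (intro image_eqI) (simp_all del: transpose_matrix_vector)
  qed
  moreover have meas: "(*v) (transpose \<sigma>) -` S \<in> sets borel"
    using measurable_sets[of "(*v) (transpose \<sigma>)" borel borel S] S
    by (simp add: borel_measurable_continuous_onI matrix_vector_mult_linear_continuous_on del: transpose_matrix_vector)
  moreover have "emeasure lebesgue ((\<lambda>u. c *\<^sub>R u + z) ` ((*v) \<sigma> ` S))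
      = ennreal (\<bar>c\<bar> ^ CARD('n)) * emeasure lebesgue ((*v) \<sigma> ` S)"
    by (simp add: emeasure_lebesgue_affine ennreal_power)
  moreover have "emeasure lebesgue ((*v) (transpose \<sigma>) -` S) = emeasure lborel ((*v) (transpose \<sigma>) -` S)"
    using meas by (simp del: transpose_matrix_vector)
  moreover have "(\<lambda>u. c *\<^sub>R (\<sigma> *v u) + z) ` S = (\<lambda>u. c *\<^sub>R u + z) ` ((*v) \<sigma> ` S)"
    by (simp add: image_image)
  ultimately show ?thesis
    using emeasure_lborel_orthogonal_vimage[OF T S] by (simp only:)
qed

text \<open>For orthogonal \<open>\<sigma>\<close> and positive \<open>\<tau>\<close> this inverts
  the linear part of the motion. Membership in a moved set then becomes membership of a point in the
  fixed body, a condition jointly measurable in all parameters.\<close>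

definition pullback :: "real \<Rightarrow> real^'n^'n \<Rightarrow> real^'n \<Rightarrow> real^'n"
  where "pullback \<tau> \<sigma> y = (1 / \<tau>) *\<^sub>R (transpose \<sigma> *v y)"

lemma continuous_on_transpose_mult:
  "continuous_on UNIV (\<lambda>x. transpose (fst x :: real^'n^'n) *v (snd x :: real^'n))"
  unfolding matrix_vector_mult_def transpose_def
  by (intro continuous_on_vec_lambda continuous_intros)

lemma borel_measurable_pullback:
  assumes [measurable]: "t \<in> borel_measurable M" "s \<in> borel_measurable M" "y \<in> borel_measurable M"
  shows "(\<lambda>x. pullback (t x) (s x :: real^'n^'n) (y x)) \<in> borel_measurable M"
proof -
  have [measurable]: "(\<lambda>x. transpose (s x) *v (y x)) \<in> borel_measurable M"
    using assms(2,3) continuous_on_transpose_mult by (rule borel_measurable_continuous_Pair)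
  show ?thesis unfolding pullback_def by measurable
qed

lemma pullback_diff: "pullback \<tau> \<sigma> (x - y) = pullback \<tau> \<sigma> x - pullback \<tau> \<sigma> y"
  by (simp add: pullback_def matrix_vector_mult_diff_distrib scaleR_diff_right)

lemma norm_pullback:
  assumes "orthogonal_matrix \<sigma>" "0 < \<tau>"
  shows "norm (pullback \<tau> \<sigma> y) = norm y / \<tau>"
proof -
  have "orthogonal_transformation ((*v) (transpose \<sigma>))"
    using assms(1) by (simp add: orthogonal_transformation_matrix orthogonal_matrix_transpose)
  then show ?thesis
    using assms(2) by (simp add: pullback_def orthogonal_transformation_norm del: transpose_matrix_vector)
qed

lemma pullback_inverse:
  assumes "orthogonal_matrix \<sigma>" "0 < \<tau>"
  shows "pullback \<tau> \<sigma> (\<tau> *\<^sub>R (\<sigma> *v u)) = u" "\<tau> *\<^sub>R (\<sigma> *v pullback \<tau> \<sigma> y) = y"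
  using assms
  by (simp_all add: pullback_def orthogonal_matrix_def matrix_vector_mul_assoc matrix_vector_mult_scaleR
      del: transpose_matrix_vector)

lemma mem_moved_set_iff:
  assumes "orthogonal_matrix \<sigma>" "0 < \<tau>"
  shows "y \<in> moved_set x \<tau> \<sigma> \<Omega> \<longleftrightarrow> pullback \<tau> \<sigma> (y - x) \<in> \<Omega>"
proof
  assume "y \<in> moved_set x \<tau> \<sigma> \<Omega>"
  then show "pullback \<tau> \<sigma> (y - x) \<in> \<Omega>"
    by (auto simp: moved_set_def pullback_inverse[OF assms])
next
  assume "pullback \<tau> \<sigma> (y - x) \<in> \<Omega>"
  then show "y \<in> moved_set x \<tau> \<sigma> \<Omega>"
    unfolding moved_set_def
    by (rule image_eqI[rotated]) (simp add: pullback_inverse[OF assms])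
qed

text \<open>The integrand is the indicator of the translations \<open>x\<close> that separate
  \<open>z\<close> and \<open>w\<close>. Substituting \<open>x = z - \<tau> \<sigma> u\<close> turns
  these into the points \<open>u\<close> that a shift by the pulled back \<open>w - z\<close>, of
  length \<open>norm (z - w) / \<tau>\<close>, moves across the boundary of the body.\<close>

lemma nn_integral_indicator_difference_le:
  fixes \<Omega> :: "(real^'n) set" and \<beta> c :: real
  assumes \<Omega>[measurable]: "\<Omega> \<in> sets borel" and bdd: "bounded \<Omega>" and \<beta>: "0 < \<beta>" and c: "0 < c"
    and bdry: "\<And>t. 0 < t \<Longrightarrow> t < 1 \<Longrightarrow>
      emeasure lebesgue {z. infdist z (frontier \<Omega>) \<le> t} \<le> ennreal (c * t powr \<beta>)"
    and \<sigma>: "orthogonal_matrix \<sigma>" and \<tau>: "0 < \<tau>"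
  shows "(\<integral>\<^sup>+ x. ennreal \<bar>indicat_real \<Omega> (pullback \<tau> \<sigma> (z - x)) - indicat_real \<Omega> (pullback \<tau> \<sigma> (w - x))\<bar> \<partial>lborel)
     \<le> ennreal (\<tau> ^ CARD('n) * (c + 2 * measure lborel \<Omega>) * (norm (z - w) / \<tau>) powr \<beta>)"
proof -
  let ?v = "pullback \<tau> \<sigma> (w - z)"
  let ?S = "{u. (u \<in> \<Omega>) \<noteq> (u + ?v \<in> \<Omega>)}"
  let ?X = "{x. (pullback \<tau> \<sigma> (z - x) \<in> \<Omega>) \<noteq> (pullback \<tau> \<sigma> (w - x) \<in> \<Omega>)}"
  have [measurable]: "(\<lambda>x. pullback \<tau> \<sigma> (y - x)) \<in> borel_measurable borel" for y
    by (intro borel_measurable_pullback) auto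
  have X: "?X \<in> sets borel" by measurable
  have S: "?S \<in> sets borel" by measurable
  have S_le: "emeasure lborel ?S \<le> ennreal ((c + 2 * measure lborel \<Omega>) * norm ?v powr \<beta>)"
    by (rule emeasure_translation_difference_le[OF \<Omega> bdd \<beta> c bdry])
  have "?X = (\<lambda>u. (- \<tau>) *\<^sub>R (\<sigma> *v u) + z) ` ?S"
  proof (intro set_eqI iffI)
    fix x assume "x \<in> ?X"
    then have "pullback \<tau> \<sigma> (z - x) \<in> ?S" by (simp add: pullback_diff)
    moreover have "x = (- \<tau>) *\<^sub>R (\<sigma> *v pullback \<tau> \<sigma> (z - x)) + z"
      using pullback_inverse(2)[OF \<sigma> \<tau>, of "z - x"] by simp
    ultimately show "x \<in> (\<lambda>u. (- \<tau>) *\<^sub>R (\<sigma> *v u) + z) ` ?S" by blast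
  next
    fix x assume "x \<in> (\<lambda>u. (- \<tau>) *\<^sub>R (\<sigma> *v u) + z) ` ?S"
    then obtain u where u: "u \<in> ?S" "x = (- \<tau>) *\<^sub>R (\<sigma> *v u) + z" by blast
    have "u = pullback \<tau> \<sigma> (z - x)"
      using pullback_inverse(1)[OF \<sigma> \<tau>, of u] u(2) by simp
    moreover from this have "u + ?v = pullback \<tau> \<sigma> (w - x)"
      by (simp add: pullback_diff)
    ultimately show "x \<in> ?X" using u(1) by simp
  qed
  then have "emeasure lborel ?X = ennreal (\<tau> ^ CARD('n)) * emeasure lborel ?S"
    using emeasure_similarity_image[OF \<sigma> S, of "- \<tau>" z] \<tau> X
    by (simp add: emeasure_completion)
  also have "\<dots> \<le> ennreal (\<tau> ^ CARD('n)) * ennreal ((c + 2 * measure lborel \<Omega>) * norm ?v powr \<beta>)"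
    using S_le by (rule mult_left_mono) simp
  also have "\<dots> = ennreal (\<tau> ^ CARD('n) * (c + 2 * measure lborel \<Omega>) * (norm (z - w) / \<tau>) powr \<beta>)"
    using \<tau> c by (subst ennreal_mult[symmetric])
      (auto simp: norm_pullback[OF \<sigma> \<tau>] norm_minus_commute mult.assoc)
  finally have "emeasure lborel ?X \<le> \<dots>" .
  moreover have "(\<integral>\<^sup>+ x. ennreal \<bar>indicat_real \<Omega> (pullback \<tau> \<sigma> (z - x)) - indicat_real \<Omega> (pullback \<tau> \<sigma> (w - x))\<bar> \<partial>lborel)
      = (\<integral>\<^sup>+ x. indicator ?X x \<partial>lborel)"
    by (intro nn_integral_cong) (auto simp: indicator_def)
  ultimately show ?thesis
    using X by simp
qed

subsection \<open>The discrepancy bound\<close>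

text \<open>The pieces need not cover \<open>E\<close>. Equality of the total measures makes the
  uncovered part a null set, which no \<open>R\<close> can detect.\<close>

lemma sum_measure_partition_Int:
  fixes A :: "nat \<Rightarrow> 'a set"
  assumes E: "E \<in> fmeasurable M" and R: "R \<in> sets M" and A: "\<And>j. j < N \<Longrightarrow> A j \<in> sets M" "\<And>j. j < N \<Longrightarrow> A j \<subseteq> E"
    and disj: "disjoint_family_on A {..<N}" and total: "(\<Sum>j<N. measure M (A j)) = measure M E"
  shows "(\<Sum>j<N. measure M (A j \<inter> R)) = measure M (E \<inter> R)"
proof -
  have fA: "A j \<in> fmeasurable M" if "j < N" for j
    using that by (intro fmeasurableI2[OF E] A)
  let ?U = "\<Union>j<N. A j"
  have U: "?U \<in> fmeasurable M" "?U \<subseteq> E"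
    using fA A(2) by (auto intro!: fmeasurable.finite_UN)
  have "measure M ?U = measure M E"
    using total disj fA by (subst measure_finite_Union) (auto simp: fmeasurableD2 intro: fmeasurableD)
  then have null: "measure M (E - ?U) = 0"
    using measurable_measure_Diff[OF E _ U(2)] U(1) by (simp add: fmeasurableD)
  have UR: "?U \<inter> R \<in> fmeasurable M"
    using U R by (simp add: fmeasurable_Int_fmeasurable)
  have ER: "E \<inter> R \<in> fmeasurable M"
    using E R by (simp add: fmeasurable_Int_fmeasurable)
  have "(\<Sum>j<N. measure M (A j \<inter> R)) = measure M (\<Union>j<N. A j \<inter> R)"
  proof (intro measure_finite_Union[symmetric])
    have "A j \<inter> R \<in> fmeasurable M" if "j < N" for j
      using fA[OF that] R by (rule fmeasurable_Int_fmeasurable)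
    then show "(\<lambda>j. A j \<inter> R) ` {..<N} \<subseteq> sets M"
      and "\<And>j. j \<in> {..<N} \<Longrightarrow> emeasure M (A j \<inter> R) \<noteq> \<infinity>"
      by (auto simp: fmeasurableD2 intro: fmeasurableD)
    show "disjoint_family_on (\<lambda>j. A j \<inter> R) {..<N}"
      using disj by (auto simp: disjoint_family_on_def)
  qed simp
  also have "(\<Union>j<N. A j \<inter> R) = ?U \<inter> R" by blast
  also have "measure M (?U \<inter> R) = measure M (E \<inter> R)"
  proof (rule antisym)
    show "measure M (?U \<inter> R) \<le> measure M (E \<inter> R)"
      using U(2) ER UR by (intro measure_mono_fmeasurable) (auto dest: fmeasurableD)
    have "measure M (E \<inter> R) \<le> measure M ((?U \<inter> R) \<union> (E - ?U))"
      using ER UR E U by (intro measure_mono_fmeasurable) (auto dest: fmeasurableD)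
    also have "\<dots> \<le> measure M (?U \<inter> R) + measure M (E - ?U)"
      using UR E U by (intro measure_Un_le) (auto dest: fmeasurableD)
    finally show "measure M (E \<inter> R) \<le> measure M (?U \<inter> R)" using null by simp
  qed
  finally show ?thesis .
qed

lemma moved_set_borel:
  assumes [measurable]: "\<Omega> \<in> sets borel" and "orthogonal_matrix \<sigma>" "0 < \<tau>"
  shows "moved_set x \<tau> \<sigma> \<Omega> \<in> sets borel"
proof -
  have [measurable]: "(\<lambda>y. pullback \<tau> \<sigma> (y - x)) \<in> borel_measurable borel"
    by (intro borel_measurable_pullback) auto
  have "moved_set x \<tau> \<sigma> \<Omega> = {y. pullback \<tau> \<sigma> (y - x) \<in> \<Omega>}"
    using mem_moved_set_iff[OF assms(2,3)] by blast
  also have "\<dots> \<in> sets borel" by measurable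
  finally show ?thesis .
qed

text \<open>Disjoint pieces give distinct points, so counting points is summing indicators over the
  indices. As all pieces have measure \<open>|E| / N\<close>, the mean of the indicator over a piece
  is \<open>N |A j \<inter> R| / |E|\<close>, and these means add up to the expected count.\<close>

lemma discrepancy_eq_sum:
  fixes E R :: "(real^'n) set" and z :: "nat \<Rightarrow> real^'n"
  assumes E: "E \<in> sets borel" "bounded E" "0 < measure lborel E" and R: "R \<in> sets borel"
    and A: "\<And>j. j < N \<Longrightarrow> A j \<in> sets borel" "\<And>j. j < N \<Longrightarrow> A j \<subseteq> E" "disjoint_family_on A {..<N}"
    and A_measure: "\<And>j. j < N \<Longrightarrow> measure lborel (A j) = measure lborel E / real N"
    and N: "N > 0" and z: "\<And>j. j < N \<Longrightarrow> z j \<in> A j"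
  shows "discrepancy E (z ` {..<N}) R
     = (\<Sum>j<N. indicat_real R (z j) - (\<integral>w. indicat_real R w \<partial>uniform_measure lborel (A j)))"
    and "card (z ` {..<N}) = N"
proof -
  have inj: "inj_on z {..<N}"
  proof (intro inj_onI)
    fix i j assume "i \<in> {..<N}" "j \<in> {..<N}" "z i = z j"
    with z[of i] z[of j] have "A i \<inter> A j \<noteq> {}" by auto
    with A(3) \<open>i \<in> {..<N}\<close> \<open>j \<in> {..<N}\<close> show "i = j"
      unfolding disjoint_family_on_def by blast
  qed
  show card: "card (z ` {..<N}) = N"
    using inj by (simp add: card_image)
  have "real (card (z ` {..<N} \<inter> R)) = (\<Sum>y\<in>z ` {..<N}. indicat_real R y)"
    by (simp add: indicator_def sum.inter_restrict[symmetric])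
  also have "\<dots> = (\<Sum>j<N. indicat_real R (z j))"
    using inj by (simp add: sum.reindex)
  finally have count: "real (card (z ` {..<N} \<inter> R)) = (\<Sum>j<N. indicat_real R (z j))" .
  have fE: "E \<in> fmeasurable lborel"
    using E emeasure_bounded_finite by (auto simp: fmeasurable_def)
  have mean: "(\<integral>w. indicat_real R w \<partial>uniform_measure lborel (A j))
      = measure lborel (A j \<inter> R) * real N / measure lborel E" if j: "j < N" for j
  proof -
    have "emeasure lborel (A j) \<noteq> 0"
      using A_measure[OF j] E(3) N by (auto simp: measure_def)
    moreover have "emeasure lborel (A j) \<noteq> \<infinity>"
      using fmeasurableI2[OF fE A(2)[OF j]] A(1)[OF j] by (simp add: fmeasurableD2)
    ultimately have "measure (uniform_measure lborel (A j)) R = measure lborel (A j \<inter> R) / measure lborel (A j)"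
      using R by simp
    then show ?thesis
      using R A_measure[OF j] by simp
  qed
  have "(\<Sum>j<N. measure lborel (A j)) = measure lborel E"
    using A_measure N by simp
  then have total: "(\<Sum>j<N. measure lborel (A j \<inter> R)) = measure lborel (E \<inter> R)"
    using A R by (intro sum_measure_partition_Int[OF fE]) auto
  have "(\<Sum>j<N. \<integral>w. indicat_real R w \<partial>uniform_measure lborel (A j))
      = (\<Sum>j<N. measure lborel (A j \<inter> R)) * real N / measure lborel E"
    unfolding sum_distrib_right sum_divide_distrib by (intro sum.cong mean) auto
  also have "\<dots> = real N * mu_E E R"
    using E R by (simp add: total mu_E_def measure_completion)
  finally show "discrepancy E (z ` {..<N}) R
     = (\<Sum>j<N. indicat_real R (z j) - (\<integral>w. indicat_real R w \<partial>uniform_measure lborel (A j)))"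
    by (simp add: discrepancy_def card count sum_subtractf)
qed

text \<open>Connects the iterated integral of the theorem with the single parameter measure of the
  averaging lemmas, by applying Tonelli twice.\<close>

lemma nn_integral_restrict_triple:
  fixes f :: "real \<times> 'b \<times> 'c::euclidean_space \<Rightarrow> ennreal"
  assumes M: "sigma_finite_measure M" and S: "S \<in> sets borel"
    and f: "f \<in> borel_measurable (restrict_space lborel S \<Otimes>\<^sub>M (M \<Otimes>\<^sub>M lborel))"
  shows "(\<integral>\<^sup>+ \<theta>. f \<theta> \<partial>(restrict_space lborel S \<Otimes>\<^sub>M (M \<Otimes>\<^sub>M lborel)))
    = (\<integral>\<^sup>+ t\<in>S. (\<integral>\<^sup>+ s. (\<integral>\<^sup>+ x. f (t, s, x) \<partial>lborel) \<partial>M) \<partial>lborel)"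
proof -
  interpret pair: sigma_finite_measure "M \<Otimes>\<^sub>M (lborel :: 'c measure)"
    using M by (intro sigma_finite_pair_measure sigma_finite_lborel)
  have "(\<integral>\<^sup>+ \<theta>. f \<theta> \<partial>(restrict_space lborel S \<Otimes>\<^sub>M (M \<Otimes>\<^sub>M lborel)))
      = (\<integral>\<^sup>+ t. (\<integral>\<^sup>+ y. f (t, y) \<partial>(M \<Otimes>\<^sub>M lborel)) \<partial>restrict_space lborel S)"
    using f by (rule pair.nn_integral_fst[symmetric])
  also have "\<dots> = (\<integral>\<^sup>+ t. (\<integral>\<^sup>+ s. (\<integral>\<^sup>+ x. f (t, s, x) \<partial>lborel) \<partial>M) \<partial>restrict_space lborel S)"
  proof (rule nn_integral_cong)
    fix t assume t: "t \<in> space (restrict_space lborel S)"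
    have "(\<lambda>y. f (t, y)) \<in> borel_measurable (M \<Otimes>\<^sub>M lborel)"
      using measurable_compose[OF measurable_Pair1'[OF t] f] .
    then show "(\<integral>\<^sup>+ y. f (t, y) \<partial>(M \<Otimes>\<^sub>M lborel)) = (\<integral>\<^sup>+ s. (\<integral>\<^sup>+ x. f (t, s, x) \<partial>lborel) \<partial>M)"
      by (rule lborel.nn_integral_fst[symmetric])
  qed
  also have "\<dots> = (\<integral>\<^sup>+ t\<in>S. (\<integral>\<^sup>+ s. (\<integral>\<^sup>+ x. f (t, s, x) \<partial>lborel) \<partial>M) \<partial>lborel)"
    using S by (intro nn_integral_restrict_space) simp
  finally show ?thesis .
qed

theorem theorem7:
  fixes E \<Omega> :: "(real^'n) set" and \<nu> :: "(real^'n^'n) measure"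
    and c1 c' \<beta> a b :: real
  assumes d2: "CARD('n) \<ge> 2"
    and E_borel: "E \<in> sets borel" and E_bdd: "bounded E"
    and E_pos: "measure lebesgue E > 0"
    and c1_pos: "c1 > 0"
    and E_reg: "\<forall>x\<in>E. \<forall>r. 0 < r \<and> r < diameter E \<longrightarrow>
                   c1 * r ^ CARD('n) \<le> mu_E E (ball x r)"
    and Om_borel: "\<Omega> \<in> sets borel" and Om_bdd: "bounded \<Omega>"
    and beta: "0 < \<beta>" "\<beta> \<le> 1" and c'_pos: "c' > 0"
    and Om_bdry: "\<forall>t. 0 < t \<and> t < 1 \<longrightarrow>
          emeasure lebesgue {z. infdist z (frontier \<Omega>) \<le> t} \<le> ennreal (c' * t powr \<beta>)"
    and ab: "0 < a" "a < b"
    and haar: "is_haar_SO \<nu>"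
  shows "\<exists>c>0. \<forall>N::nat. \<exists>P. finite P \<and> card P = N \<and> P \<subseteq> E \<and>
           (\<integral>\<^sup>+ \<tau>\<in>{a..b}. (\<integral>\<^sup>+ \<sigma>. (\<integral>\<^sup>+ x.
               ennreal ((discrepancy E P (moved_set x \<tau> \<sigma> \<Omega>))\<^sup>2) \<partial>lebesgue) \<partial>\<nu>) \<partial>lborel)
           \<le> ennreal ((c * real N powr (1/2 - \<beta> / (2 * real CARD('n))))\<^sup>2)"
proof -
  let ?d = "CARD('n)"
  have sets_\<nu>: "sets \<nu> = sets (restrict_space borel SO_set)" and "prob_space \<nu>"
    using haar by (auto simp: is_haar_SO_def)
  interpret \<nu>: prob_space \<nu> by fact
  have orth: "orthogonal_matrix \<sigma>" if "\<sigma> \<in> space \<nu>" for \<sigma>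
    using that sets_eq_imp_space_eq[OF sets_\<nu>] by (simp add: space_restrict_space SO_set_def)
  have pos: "0 < measure lborel E"
    using E_pos E_borel by (simp add: measure_completion)
  obtain C where C: "C > 0" and part: "\<And>N::nat. N > 0 \<Longrightarrow> \<exists>A r.
     (\<forall>j<N. A j \<in> sets borel \<and> A j \<subseteq> E \<and> measure lborel (A j) = measure lborel E / real N) \<and>
     disjoint_family_on A {..<N} \<and>
     (\<forall>j<N. \<forall>z\<in>A j. \<forall>w\<in>A j. norm (z - w) powr \<beta> \<le> r j) \<and>
     (\<Sum>j<N. r j) \<le> C * real N powr (1 - \<beta> / real ?d)"
    using exists_equal_measure_partition[OF E_borel E_bdd pos beta] by blast
  \<comment> \<open>The worst case of the separation bound over \<open>\<tau>\<close> between
    \<open>a\<close> and \<open>b\<close>: \<open>b\<close> bounds the growing factor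
    \<open>\<tau> ^ d\<close> and \<open>a\<close> the decreasing factor
    \<open>\<tau> powr - \<beta>\<close>.\<close>
  define C0 where "C0 = b ^ ?d * (c' + 2 * measure lborel \<Omega>) * a powr - \<beta>"
  have C0: "0 < C0"
    using ab c'_pos by (simp add: C0_def add_pos_nonneg)
  \<comment> \<open>The dilations contribute the length of their interval, the rotations a total
    mass of 1.\<close>
  define D where "D = (b - a) * C0"
  have D: "0 < D" using C0 ab by (simp add: D_def)
  define I where "I = restrict_space (lborel :: real measure) {a..b}"
  define Q where "Q = I \<Otimes>\<^sub>M (\<nu> \<Otimes>\<^sub>M (lborel :: (real^'n) measure))"
  have sigma_Q: "sigma_finite_measure Q"
    unfolding Q_def I_def
    by (intro sigma_finite_pair_measure sigma_finite_measure_restrict_space sigma_finite_lborel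
        \<nu>.sigma_finite_measure_axioms) simp
  \<comment> \<open>Defined for all matrices and dilations, \<open>h\<close> is measurable on the
    whole parameter space. It is identified with the indicator of the moved set for
    \<open>\<tau>\<close> between \<open>a\<close> and \<open>b\<close> and \<open>\<sigma>\<close>
    in the rotation group (\<open>h_moved\<close>).\<close>
  define h where "h \<theta> w = indicat_real \<Omega> (pullback (fst \<theta>) (fst (snd \<theta>)) (w - snd (snd \<theta>)))"
    for \<theta> :: "real \<times> (real^'n^'n) \<times> (real^'n)" and w
  have id_I: "(\<lambda>x. x) \<in> borel_measurable I"
    unfolding I_def by (intro measurable_restrict_space1) simp
  have "(\<lambda>x. x) \<in> borel_measurable (restrict_space (borel :: (real^'n^'n) measure) SO_set)"
    by (intro measurable_restrict_space1) simp
  then have id_\<nu>: "(\<lambda>x. x) \<in> borel_measurable \<nu>"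
    by (simp add: measurable_cong_sets[OF sets_\<nu> refl])
  \<comment> \<open>Stated for compositions, because it is needed both with a fixed point and with
    the point as a further variable. Dilations and rotations carry trace sigma-algebras, so they
    enter the borel spaces through the inclusions \<open>id_I\<close> and
    \<open>id_\<nu>\<close>.\<close>
  have h_measurable: "(\<lambda>x. h (f x) (g x)) \<in> borel_measurable M"
    if f: "f \<in> measurable M Q" and g: "g \<in> borel_measurable M" for f g and M :: "'z measure"
  proof -
    have m1: "(\<lambda>x. fst (f x)) \<in> measurable M I" and m2: "(\<lambda>x. fst (snd (f x))) \<in> measurable M \<nu>"
      and m3: "(\<lambda>x. snd (snd (f x))) \<in> measurable M lborel"
      using f unfolding Q_def by measurable
    have [measurable]: "(\<lambda>x. pullback (fst (f x)) (fst (snd (f x))) (g x - snd (snd (f x)))) \<in> borel_measurable M"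
      using measurable_compose[OF m1 id_I] measurable_compose[OF m2 id_\<nu>] m3 g
      by (intro borel_measurable_pullback borel_measurable_diff) auto
    show ?thesis
      unfolding h_def using Om_borel by measurable
  qed
  have h_pair_measurable: "(\<lambda>(\<theta>, z). h \<theta> z) \<in> borel_measurable (Q \<Otimes>\<^sub>M p)"
    if p: "sets p = sets borel" for p
    unfolding split_beta'
    by (intro h_measurable measurable_fst) (subst measurable_cong_sets[OF refl p[symmetric]], rule measurable_snd)
  have h01: "0 \<le> h \<theta> z" "h \<theta> z \<le> 1" for \<theta> z
    by (simp_all add: h_def)
  have h_moved: "h (\<tau>, \<sigma>, x) w = indicat_real (moved_set x \<tau> \<sigma> \<Omega>) w"
    if "\<tau> \<in> {a..b}" "\<sigma> \<in> space \<nu>" for \<tau> \<sigma> x w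
    using mem_moved_set_iff[OF orth[OF that(2)], of \<tau> w x \<Omega>] that(1) ab by (simp add: h_def indicator_def)
  have h_diff: "(\<integral>\<^sup>+ \<theta>. ennreal \<bar>h \<theta> z - h \<theta> w\<bar> \<partial>Q) \<le> ennreal (D * \<rho>)"
    if \<rho>: "norm (z - w) powr \<beta> \<le> \<rho>" for z w \<rho>
  proof -
    have bound: "(\<integral>\<^sup>+ x. ennreal \<bar>h (\<tau>, \<sigma>, x) z - h (\<tau>, \<sigma>, x) w\<bar> \<partial>lborel) \<le> ennreal (C0 * \<rho>)"
      if \<tau>: "\<tau> \<in> {a..b}" and \<sigma>: "\<sigma> \<in> space \<nu>" for \<tau> \<sigma>
    proof -
      have \<tau>0: "0 < \<tau>" using \<tau> ab by simp
      have "(\<integral>\<^sup>+ x. ennreal \<bar>h (\<tau>, \<sigma>, x) z - h (\<tau>, \<sigma>, x) w\<bar> \<partial>lborel)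
          \<le> ennreal (\<tau> ^ ?d * (c' + 2 * measure lborel \<Omega>) * (norm (z - w) / \<tau>) powr \<beta>)"
        unfolding h_def fst_conv snd_conv
        using Om_bdry by (intro nn_integral_indicator_difference_le Om_borel Om_bdd beta c'_pos orth[OF \<sigma>] \<tau>0) auto
      also have "\<tau> ^ ?d * (c' + 2 * measure lborel \<Omega>) * (norm (z - w) / \<tau>) powr \<beta>
          = \<tau> ^ ?d * (c' + 2 * measure lborel \<Omega>) * \<tau> powr - \<beta> * norm (z - w) powr \<beta>"
        using \<tau>0 by (simp add: powr_divide powr_minus field_simps)
      also have "\<dots> \<le> C0 * \<rho>"
        unfolding C0_def using \<tau> \<tau>0 ab c'_pos beta \<rho>
        by (intro mult_mono power_mono powr_mono2') (auto intro: order_trans[OF powr_ge_zero \<rho>])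
      finally show ?thesis by (simp add: ennreal_leI)
    qed
    have meas: "(\<lambda>\<theta>. ennreal \<bar>h \<theta> z - h \<theta> w\<bar>) \<in> borel_measurable Q"
      using h_measurable[of "\<lambda>\<theta>. \<theta>" Q "\<lambda>_. z"] h_measurable[of "\<lambda>\<theta>. \<theta>" Q "\<lambda>_. w"] by simp
    have "(\<integral>\<^sup>+ \<theta>. ennreal \<bar>h \<theta> z - h \<theta> w\<bar> \<partial>Q)
        = (\<integral>\<^sup>+ \<tau>\<in>{a..b}. (\<integral>\<^sup>+ \<sigma>. (\<integral>\<^sup>+ x. ennreal \<bar>h (\<tau>, \<sigma>, x) z - h (\<tau>, \<sigma>, x) w\<bar> \<partial>lborel) \<partial>\<nu>) \<partial>lborel)"
      using meas unfolding Q_def I_def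
      by (intro nn_integral_restrict_triple \<nu>.sigma_finite_measure_axioms) auto
    also have "\<dots> \<le> (\<integral>\<^sup>+ \<tau>\<in>{a..b}. (\<integral>\<^sup>+ \<sigma>. ennreal (C0 * \<rho>) \<partial>\<nu>) \<partial>lborel)"
    proof (intro nn_integral_mono)
      fix \<tau> :: real
      have "(\<integral>\<^sup>+ \<sigma>. (\<integral>\<^sup>+ x. ennreal \<bar>h (\<tau>, \<sigma>, x) z - h (\<tau>, \<sigma>, x) w\<bar> \<partial>lborel) \<partial>\<nu>)
          \<le> (\<integral>\<^sup>+ \<sigma>. ennreal (C0 * \<rho>) \<partial>\<nu>)" if "\<tau> \<in> {a..b}"
        using bound[OF that] by (rule nn_integral_mono)
      then show "(\<integral>\<^sup>+ \<sigma>. (\<integral>\<^sup>+ x. ennreal \<bar>h (\<tau>, \<sigma>, x) z - h (\<tau>, \<sigma>, x) w\<bar> \<partial>lborel) \<partial>\<nu>) * indicator {a..b} \<tau>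
          \<le> (\<integral>\<^sup>+ \<sigma>. ennreal (C0 * \<rho>) \<partial>\<nu>) * indicator {a..b} \<tau>"
        by (cases "\<tau> \<in> {a..b}") (simp_all only: indicator_simps simp_thms mult_1_right mult_zero_right order_refl)
    qed
    also have "\<dots> = ennreal (C0 * \<rho>) * ennreal (b - a)"
      using ab by (simp add: \<nu>.emeasure_space_1 nn_integral_cmult_indicator)
    also have "\<dots> = ennreal (D * \<rho>)"
      using ab C0 order_trans[OF powr_ge_zero \<rho>]
      by (subst ennreal_mult[symmetric]) (auto simp: D_def mult_ac)
    finally show ?thesis .
  qed
  show ?thesis
  proof (intro exI[of _ "sqrt (D * C)"] conjI allI)
    show "sqrt (D * C) > 0" using C D by simp
    fix N :: nat
    show "\<exists>P. finite P \<and> card P = N \<and> P \<subseteq> E \<and>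
           (\<integral>\<^sup>+ \<tau>\<in>{a..b}. (\<integral>\<^sup>+ \<sigma>. (\<integral>\<^sup>+ x.
               ennreal ((discrepancy E P (moved_set x \<tau> \<sigma> \<Omega>))\<^sup>2) \<partial>lebesgue) \<partial>\<nu>) \<partial>lborel)
           \<le> ennreal ((sqrt (D * C) * real N powr (1/2 - \<beta> / (2 * real ?d)))\<^sup>2)"
    proof (cases "N = 0")
      \<comment> \<open>The empty set has discrepancy zero, which matches a right-hand side that
        vanishes because \<open>0 powr _\<close> is 0.\<close>
      case True
      then show ?thesis
        by (intro exI[of _ "{}"]) (simp add: discrepancy_def)
    next
      case False
      then have N: "N > 0" by simp
      obtain A r where A: "\<And>j. j < N \<Longrightarrow> A j \<in> sets borel" "\<And>j. j < N \<Longrightarrow> A j \<subseteq> E"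
          "disjoint_family_on A {..<N}"
        and A_measure: "\<And>j. j < N \<Longrightarrow> measure lborel (A j) = measure lborel E / real N"
        and r: "\<And>j z w. j < N \<Longrightarrow> z \<in> A j \<Longrightarrow> w \<in> A j \<Longrightarrow> norm (z - w) powr \<beta> \<le> r j"
        and r_sum: "(\<Sum>j<N. r j) \<le> C * real N powr (1 - \<beta> / real ?d)"
        using part[OF N] by metis
      define p where "p j = uniform_measure lborel (A j)" for j
      have A_emeasure: "emeasure lborel (A j) \<noteq> 0" "emeasure lborel (A j) \<noteq> \<infinity>" if "j < N" for j
      proof -
        show "emeasure lborel (A j) \<noteq> 0"
          using A_measure[OF that] pos N by (auto simp: measure_def)
        have "bounded (A j)"
          using A(2)[OF that] E_bdd by (rule bounded_subset[rotated])
        then show "emeasure lborel (A j) \<noteq> \<infinity>"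
          using emeasure_bounded_finite by fastforce
      qed
      have "\<exists>z. (\<forall>j<N. z j \<in> A j) \<and>
           (\<integral>\<^sup>+ \<theta>. ennreal ((\<Sum>j<N. h \<theta> (z j) - (\<integral>w. h \<theta> w \<partial>p j))\<^sup>2) \<partial>Q) \<le> (\<Sum>j<N. ennreal (D * r j))"
      proof (rule exists_points_square_integral_le[OF sigma_Q])
        fix j assume j: "j < N"
        show "prob_space (p j)"
          unfolding p_def using A_emeasure[OF j] by (rule prob_space_uniform_measure)
        show "(\<lambda>(\<theta>, z). h \<theta> z) \<in> borel_measurable (Q \<Otimes>\<^sub>M p j)"
          by (rule h_pair_measurable) (simp add: p_def)
        show "AE z in p j. z \<in> A j"
          unfolding p_def using A(1)[OF j] A_emeasure[OF j] by (intro AE_uniform_measureI) auto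
        show "A j \<subseteq> space (p j)"
          by (simp add: p_def)
        fix z w assume "z \<in> A j" "w \<in> A j"
        then show "(\<integral>\<^sup>+ \<theta>. ennreal \<bar>h \<theta> z - h \<theta> w\<bar> \<partial>Q) \<le> ennreal (D * r j)"
          by (intro h_diff r[OF j])
      qed (rule h01)+
      then obtain z where z: "\<And>j. j < N \<Longrightarrow> z j \<in> A j" and
        le: "(\<integral>\<^sup>+ \<theta>. ennreal ((\<Sum>j<N. h \<theta> (z j) - (\<integral>w. h \<theta> w \<partial>p j))\<^sup>2) \<partial>Q) \<le> (\<Sum>j<N. ennreal (D * r j))"
        by blast
      let ?P = "z ` {..<N}"
      \<comment> \<open>Needed to pull the sum inside \<open>ennreal\<close>, which would truncate
        negative terms. Each piece has a point, and the distance of that point to itself already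
        gives the sign.\<close>
      have r0: "0 \<le> r j" if "j < N" for j
        using order_trans[OF powr_ge_zero r[OF that z[OF that] z[OF that]]] .
      have disc: "discrepancy E ?P (moved_set x \<tau> \<sigma> \<Omega>) = (\<Sum>j<N. h (\<tau>, \<sigma>, x) (z j) - (\<integral>w. h (\<tau>, \<sigma>, x) w \<partial>p j))"
        if \<tau>: "\<tau> \<in> {a..b}" and \<sigma>: "\<sigma> \<in> space \<nu>" for \<tau> \<sigma> x
        unfolding h_moved[OF \<tau> \<sigma>] p_def
        using \<tau> ab by (intro discrepancy_eq_sum E_borel E_bdd pos moved_set_borel Om_borel orth[OF \<sigma>] A A_measure N z) auto
      have meas: "(\<lambda>\<theta>. ennreal ((\<Sum>j<N. h \<theta> (z j) - (\<integral>w. h \<theta> w \<partial>p j))\<^sup>2)) \<in> borel_measurable Q"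
      proof -
        have "(\<lambda>\<theta>. \<integral>w. h \<theta> w \<partial>p j) \<in> borel_measurable Q" if j: "j < N" for j
        proof -
          interpret pj: prob_space "p j"
            unfolding p_def using A_emeasure[OF j] by (rule prob_space_uniform_measure)
          have "(\<lambda>(\<theta>, z). h \<theta> z) \<in> borel_measurable (Q \<Otimes>\<^sub>M p j)"
            by (rule h_pair_measurable) (simp add: p_def)
          then show ?thesis
            by (rule pj.borel_measurable_lebesgue_integral)
        qed
        moreover have "(\<lambda>\<theta>. h \<theta> (z j)) \<in> borel_measurable Q" for j
          by (rule h_measurable) simp_all
        ultimately show ?thesis
          by (intro measurable_compose[OF _ measurable_ennreal] borel_measurable_power
              borel_measurable_sum borel_measurable_diff) auto
      qed
      \<comment> \<open>The identity for the discrepancy holds for \<open>\<tau>\<close> between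
        \<open>a\<close> and \<open>b\<close> only; the indicator removes the other values. Passing
        from the completed measure to \<open>lborel\<close> leaves the inner integral
        unchanged.\<close>
      have "(\<integral>\<^sup>+ \<tau>\<in>{a..b}. (\<integral>\<^sup>+ \<sigma>. (\<integral>\<^sup>+ x.
               ennreal ((discrepancy E ?P (moved_set x \<tau> \<sigma> \<Omega>))\<^sup>2) \<partial>lebesgue) \<partial>\<nu>) \<partial>lborel)
          = (\<integral>\<^sup>+ \<tau>\<in>{a..b}. (\<integral>\<^sup>+ \<sigma>. (\<integral>\<^sup>+ x.
               ennreal ((\<Sum>j<N. h (\<tau>, \<sigma>, x) (z j) - (\<integral>w. h (\<tau>, \<sigma>, x) w \<partial>p j))\<^sup>2) \<partial>lborel) \<partial>\<nu>) \<partial>lborel)"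
        by (intro nn_integral_cong)
           (auto simp: indicator_def nn_integral_completion disc intro!: nn_integral_cong)
      also have "\<dots> = (\<integral>\<^sup>+ \<theta>. ennreal ((\<Sum>j<N. h \<theta> (z j) - (\<integral>w. h \<theta> w \<partial>p j))\<^sup>2) \<partial>Q)"
        using meas unfolding Q_def I_def
        by (intro nn_integral_restrict_triple[symmetric] \<nu>.sigma_finite_measure_axioms) auto
      also have "\<dots> \<le> (\<Sum>j<N. ennreal (D * r j))" by (rule le)
      also have "\<dots> = ennreal (D * (\<Sum>j<N. r j))"
        using D r0 by (subst sum_ennreal) (auto simp: sum_distrib_left)
      also have "\<dots> \<le> ennreal (D * (C * real N powr (1 - \<beta> / real ?d)))"
        using D r_sum by (intro ennreal_leI mult_left_mono) auto
      also have "D * (C * real N powr (1 - \<beta> / real ?d))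
          = (sqrt (D * C) * real N powr (1/2 - \<beta> / (2 * real ?d)))\<^sup>2"
      proof -
        have "(real N powr (1/2 - \<beta> / (2 * real ?d)))\<^sup>2 = real N powr (1 - \<beta> / real ?d)"
          by (simp add: power2_eq_square powr_add[symmetric])
        then show ?thesis
          using C D by (simp add: power_mult_distrib)
      qed
      \<comment> \<open>The cardinality does not depend on the test set, so the lemma is
        instantiated with the empty one.\<close>
      finally show ?thesis
        using z A(2) discrepancy_eq_sum(2)[OF E_borel E_bdd pos _ A A_measure N z, of "{}"]
        by (intro exI[of _ ?P]) auto
    qed
  qed
qed

end
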